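(* For any Coxeter group $W=\langle s_i\mid i\in I\rangle$ the algebra $\hat{\mathbf{H}}(W)$ is a Hopf algebra with the coproduct $\Delta$, the counit $\varepsilon$, and the antipode anti-automorphism $S$ given respectively by (for $i\in I$): $$\Delta(s_i)=s_i\otimes s_i,\quad \Delta(D_i)=D_i\otimes 1+s_i\otimes D_i,\quad \varepsilon(s_i)=1,\quad \varepsilon(D_i)=0,\quad S(s_i)=s_i,\quad S(D_i)=-s_iD_i.$$
   Context: A Coxeter group $W$ is generated by $s_i$, $i\in I$, subject to relations $(s_is_j)^{m_{ij}}=1$, where $m_{ij}=m_{ji}\in\mathbb{Z}_{\ge 0}$ are such that $m_{ij}=1$ iff $i=j$ ($m_{ij}=0$ imposes no relation). $\hat{\mathbf{H}}(W)$ is the (unital associative) $\mathbb{Z}$-algebra generated by $s_i,D_i$, $i\in I$, subject to relations: (i) Rank 1 relations: $s_i^2=1$, $D_i^2=D_i$, $s_iD_i+D_is_i=s_i-1$ for $i\in I$. (ii) Coxeter relations: $(s_is_j)^{m_{ij}}=1$. (iii) Linear braid relations: $\underbrace{D_is_js_i\cdots s_{j'}}_{m_{ij}}=\underbrace{s_j\cdots s_{i'}s_{j'}D_{i'}}_{m_{ij}}$ for all distinct $i,j\in I$ with $m_{ij}\ne 0$, where $i'=i$ if $m_{ij}$ is even, $i'=j$ if $m_{ij}$ is odd, and $\{i',j'\}=\{i,j\}$. (Each side has $m_{ij}$ factors; the indices alternate between $i$ and $j$, the left side starting with $D_i$ followed by $s_j,s_i,\ldots$, and the right side starting with $s_j,s_i,\ldots$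 and ending in $D_{i'}$.) *)

theory Defs
  imports "HOL-Algebra.Free_Abelian_Groups" "HOL-Algebra.IntRing"
begin

section \<open>Monoid rings over the integers\<close>

definition monoid_ring :: "('a, 'b) monoid_scheme \<Rightarrow> ('a \<Rightarrow>\<^sub>0 int) ring" where
  "monoid_ring M =
    \<lparr>carrier = {p. Poly_Mapping.keys p \<subseteq> carrier M},
     monoid.mult = (\<lambda>p q. frag_extend (\<lambda>x. frag_extend (\<lambda>y. frag_of (x \<otimes>\<^bsub>M\<^esub> y)) q) p),
     one = frag_of \<one>\<^bsub>M\<^esub>,
     zero = 0,
     add = (+)\<rparr>"

definition free_monoid :: "'a set \<Rightarrow> 'a list monoid" where
  "free_monoid X = \<lparr>carrier = lists X, monoid.mult = (@), one = []\<rparr>"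

abbreviation free_algebra :: "'a set \<Rightarrow> ('a list \<Rightarrow>\<^sub>0 int) ring" where
  "free_algebra X \<equiv> monoid_ring (free_monoid X)"

section \<open>Tensor products of rings over the integers\<close>

text \<open>
  \<open>A \<otimes> B\<close> is the free abelian group on \<open>carrier A \<times> carrier B\<close> modulo the subgroup generated by
  the biadditivity relators; over the integers, compatibility with scalars follows from
  biadditivity.  The product \<open>(a \<otimes> b) (a' \<otimes> b') = a a' \<otimes> b b'\<close> is the one induced from the monoid
  ring of the multiplicative monoid \<open>A \<times>\<times> B\<close>: the additive subgroup generated by the relators is
  already a two-sided ideal there, so \<^const>\<open>FactRing\<close> applies.
\<close>

definition tensor_relators ::
  "('a, 'c) ring_scheme \<Rightarrow> ('b, 'd) ring_scheme \<Rightarrow> ('a \<times> 'b \<Rightarrow>\<^sub>0 int) set" where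
  "tensor_relators A B =
    {frag_of (a \<oplus>\<^bsub>A\<^esub> a', b) - frag_of (a, b) - frag_of (a', b) | a a' b.
       a \<in> carrier A \<and> a' \<in> carrier A \<and> b \<in> carrier B} \<union>
    {frag_of (a, b \<oplus>\<^bsub>B\<^esub> b') - frag_of (a, b) - frag_of (a, b') | a b b'.
       a \<in> carrier A \<and> b \<in> carrier B \<and> b' \<in> carrier B}"

definition tensor_kernel ::
  "('a, 'c) ring_scheme \<Rightarrow> ('b, 'd) ring_scheme \<Rightarrow> ('a \<times> 'b \<Rightarrow>\<^sub>0 int) set" where
  "tensor_kernel A B = generate (add_monoid (monoid_ring (A \<times>\<times> B))) (tensor_relators A B)"

definition tensor_ring ::
  "('a, 'c) ring_scheme \<Rightarrow> ('b, 'd) ring_scheme \<Rightarrow> ('a \<times> 'b \<Rightarrow>\<^sub>0 int) set ring" where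
  "tensor_ring A B = monoid_ring (A \<times>\<times> B) Quot tensor_kernel A B"

definition tens ::
  "('a, 'c) ring_scheme \<Rightarrow> ('b, 'd) ring_scheme \<Rightarrow> 'a \<Rightarrow> 'b \<Rightarrow> ('a \<times> 'b \<Rightarrow>\<^sub>0 int) set" where
  "tens A B a b = tensor_kernel A B +>\<^bsub>monoid_ring (A \<times>\<times> B)\<^esub> frag_of (a, b)"

text \<open>
  The additive map \<open>A \<otimes> B \<rightarrow> C\<close>, \<open>a \<otimes> b \<mapsto> \<beta> a b\<close>, for biadditive \<open>\<beta>\<close>.  For such \<open>\<beta>\<close> all
  representatives of a coset have the same value, so \<^const>\<open>the_elem\<close> is applied to a singleton.
\<close>

definition tensor_lift ::
  "('c, 'e) ring_scheme \<Rightarrow> ('a \<Rightarrow> 'b \<Rightarrow> 'c) \<Rightarrow> ('a \<times> 'b \<Rightarrow>\<^sub>0 int) set \<Rightarrow> 'c" where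
  "tensor_lift C \<beta> X =
    the_elem ((\<lambda>p. \<Oplus>\<^bsub>C\<^esub>k\<in>Poly_Mapping.keys p.
      [Poly_Mapping.lookup p k] \<cdot>\<^bsub>C\<^esub> \<beta> (fst k) (snd k)) ` X)"

text \<open>The map \<open>f \<otimes> g\<close> into \<open>A' \<otimes> B'\<close>.\<close>

definition tensor_map ::
  "('c, 'e) ring_scheme \<Rightarrow> ('d, 'f) ring_scheme \<Rightarrow> ('a \<Rightarrow> 'c) \<Rightarrow> ('b \<Rightarrow> 'd) \<Rightarrow>
    ('a \<times> 'b \<Rightarrow>\<^sub>0 int) set \<Rightarrow> ('c \<times> 'd \<Rightarrow>\<^sub>0 int) set" where
  "tensor_map A' B' f g = tensor_lift (tensor_ring A' B') (\<lambda>a b. tens A' B' (f a) (g b))"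

text \<open>The canonical map \<open>(A \<otimes> B) \<otimes> C \<rightarrow> A \<otimes> (B \<otimes> C)\<close>.\<close>

definition tensor_assoc ::
  "('a, 'd) ring_scheme \<Rightarrow> ('b, 'e) ring_scheme \<Rightarrow> ('c, 'f) ring_scheme \<Rightarrow>
    (('a \<times> 'b \<Rightarrow>\<^sub>0 int) set \<times> 'c \<Rightarrow>\<^sub>0 int) set \<Rightarrow> ('a \<times> ('b \<times> 'c \<Rightarrow>\<^sub>0 int) set \<Rightarrow>\<^sub>0 int) set" where
  "tensor_assoc A B C =
    tensor_lift (tensor_ring A (tensor_ring B C))
      (\<lambda>x c. tensor_lift (tensor_ring A (tensor_ring B C))
        (\<lambda>a b. tens A (tensor_ring B C) a (tens B C b c)) x)"

section \<open>Hopf algebras over the integers\<close>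

text \<open>
  A unital associative algebra over the integers is the same as a ring, an algebra homomorphism
  the same as a unital ring homomorphism (\<^const>\<open>ring_hom\<close> includes preservation of \<open>1\<close>), and a
  linear map the same as an additive map.
\<close>

locale bialgebra = ring H for H (structure) +
  fixes \<Delta> :: "'a \<Rightarrow> ('a \<times> 'a \<Rightarrow>\<^sub>0 int) set"
    and \<epsilon> :: "'a \<Rightarrow> int"
  assumes comult_hom: "\<Delta> \<in> ring_hom H (tensor_ring H H)"
    and counit_hom: "\<epsilon> \<in> ring_hom H \<Z>"
    and coassoc: "x \<in> carrier H \<Longrightarrow>
      tensor_assoc H H H (tensor_map (tensor_ring H H) H \<Delta> (\<lambda>b. b) (\<Delta> x)) =
      tensor_map H (tensor_ring H H) (\<lambda>a. a) \<Delta> (\<Delta> x)"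
    and counit_left: "x \<in> carrier H \<Longrightarrow> tensor_lift H (\<lambda>a b. [\<epsilon> a] \<cdot> b) (\<Delta> x) = x"
    and counit_right: "x \<in> carrier H \<Longrightarrow> tensor_lift H (\<lambda>a b. [\<epsilon> b] \<cdot> a) (\<Delta> x) = x"

locale hopf_algebra = bialgebra +
  fixes S :: "'a \<Rightarrow> 'a"
  assumes antipode_additive: "S \<in> hom (add_monoid H) (add_monoid H)"
    and antipode_left: "x \<in> carrier H \<Longrightarrow> tensor_lift H (\<lambda>a b. S a \<otimes> b) (\<Delta> x) = [\<epsilon> x] \<cdot> \<one>"
    and antipode_right: "x \<in> carrier H \<Longrightarrow> tensor_lift H (\<lambda>a b. a \<otimes> S b) (\<Delta> x) = [\<epsilon> x] \<cdot> \<one>"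

definition opposite_ring :: "('a, 'b) ring_scheme \<Rightarrow> 'a ring" where
  "opposite_ring R =
    \<lparr>carrier = carrier R,
     monoid.mult = (\<lambda>x y. y \<otimes>\<^bsub>R\<^esub> x),
     one = \<one>\<^bsub>R\<^esub>,
     zero = \<zero>\<^bsub>R\<^esub>,
     add = (\<oplus>\<^bsub>R\<^esub>)\<rparr>"

definition anti_automorphism :: "('a, 'b) ring_scheme \<Rightarrow> ('a \<Rightarrow> 'a) \<Rightarrow> bool" where
  "anti_automorphism R h \<longleftrightarrow> h \<in> ring_iso R (opposite_ring R)"

section \<open>The algebra attached to a Coxeter group\<close>

text \<open>
  A Coxeter group enters through its Coxeter matrix; the entry \<open>0\<close> stands for the absence of a
  relation.
\<close>

definition coxeter_matrix :: "'i set \<Rightarrow> ('i \<Rightarrow> 'i \<Rightarrow> nat) \<Rightarrow> bool" where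
  "coxeter_matrix I m \<longleftrightarrow>
    (\<forall>i\<in>I. \<forall>j\<in>I. m i j = m j i) \<and> (\<forall>i\<in>I. \<forall>j\<in>I. m i j = 1 \<longleftrightarrow> i = j)"

datatype 'i gen = GS 'i | GD 'i

text \<open>\<open>alt n a b\<close> is the alternating word \<open>a b a \<dots>\<close> with \<open>n\<close> letters.\<close>

fun alt :: "nat \<Rightarrow> 'a \<Rightarrow> 'a \<Rightarrow> 'a list" where
  "alt 0 a b = []"
| "alt (Suc n) a b = a # alt n b a"

definition rank1_relators :: "'i set \<Rightarrow> ('i gen list \<Rightarrow>\<^sub>0 int) set" where
  "rank1_relators I =
    {frag_of [GS i, GS i] - frag_of [] | i. i \<in> I} \<union>
    {frag_of [GD i, GD i] - frag_of [GD i] | i. i \<in> I} \<union>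
    {frag_of [GS i, GD i] + frag_of [GD i, GS i] - (frag_of [GS i] - frag_of []) | i. i \<in> I}"

definition coxeter_relators ::
  "'i set \<Rightarrow> ('i \<Rightarrow> 'i \<Rightarrow> nat) \<Rightarrow> ('i gen list \<Rightarrow>\<^sub>0 int) set" where
  "coxeter_relators I m =
    {frag_of (concat (replicate (m i j) [GS i, GS j])) - frag_of [] | i j. i \<in> I \<and> j \<in> I}"

text \<open>
  The words \<open>D\<^sub>i s\<^sub>j s\<^sub>i \<dots>\<close> and \<open>s\<^sub>j s\<^sub>i \<dots> D\<^sub>i\<^sub>'\<close> have the alternating \<open>s\<close>-word of length
  \<open>m i j - 1\<close> starting with \<open>s\<^sub>j\<close> in common.
\<close>

definition braid_relators ::
  "'i set \<Rightarrow> ('i \<Rightarrow> 'i \<Rightarrow> nat) \<Rightarrow> ('i gen list \<Rightarrow>\<^sub>0 int) set" where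
  "braid_relators I m =
    {frag_of (GD i # map GS (alt (m i j - 1) j i)) -
     frag_of (map GS (alt (m i j - 1) j i) @ [GD (if even (m i j) then i else j)]) | i j.
       i \<in> I \<and> j \<in> I \<and> i \<noteq> j \<and> m i j \<noteq> 0}"

abbreviation hecke_hopf_free :: "'i set \<Rightarrow> ('i gen list \<Rightarrow>\<^sub>0 int) ring" where
  "hecke_hopf_free I \<equiv> free_algebra (GS ` I \<union> GD ` I)"

definition hecke_hopf_ideal ::
  "'i set \<Rightarrow> ('i \<Rightarrow> 'i \<Rightarrow> nat) \<Rightarrow> ('i gen list \<Rightarrow>\<^sub>0 int) set" where
  "hecke_hopf_ideal I m =
    Idl\<^bsub>hecke_hopf_free I\<^esub> (rank1_relators I \<union> coxeter_relators I m \<union> braid_relators I m)"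

definition hecke_hopf ::
  "'i set \<Rightarrow> ('i \<Rightarrow> 'i \<Rightarrow> nat) \<Rightarrow> ('i gen list \<Rightarrow>\<^sub>0 int) set ring" where
  "hecke_hopf I m = hecke_hopf_free I Quot hecke_hopf_ideal I m"

definition gen_s :: "'i set \<Rightarrow> ('i \<Rightarrow> 'i \<Rightarrow> nat) \<Rightarrow> 'i \<Rightarrow> ('i gen list \<Rightarrow>\<^sub>0 int) set" where
  "gen_s I m i = hecke_hopf_ideal I m +>\<^bsub>hecke_hopf_free I\<^esub> frag_of [GS i]"

definition gen_D :: "'i set \<Rightarrow> ('i \<Rightarrow> 'i \<Rightarrow> nat) \<Rightarrow> 'i \<Rightarrow> ('i gen list \<Rightarrow>\<^sub>0 int) set" where
  "gen_D I m i = hecke_hopf_ideal I m +>\<^bsub>hecke_hopf_free I\<^esub> frag_of [GD i]"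

end

theory Submission
  imports Defs
begin

text \<open>
  A presented ring maps to any ring containing elements that satisfy the relations, so \<open>\<Delta>\<close>, \<open>\<epsilon>\<close> and
  \<open>S\<close> arise by checking the relations in \<open>H \<otimes> H\<close>, in the integers and in the opposite ring of
  \<open>H\<close>; they are unique because the generators determine them.  Write the linear braid relation as
  \<open>D\<^sub>i w = w D\<^sub>i\<^sub>'\<close>.  Comultiplication turns it into a consequence of itself and of \<open>s\<^sub>i w = w s\<^sub>i\<^sub>'\<close>,
  which is the usual braid relation; conjugation by \<open>w\<close> does the same for \<open>S\<close>.  Coassociativity and
  the counit laws equate ring homomorphisms, so they need only be checked on generators.  The antipode
  laws are not of this kind, but the set of elements satisfying them is closed under multiplication.
\<close>

section \<open>Additive maps out of free abelian groups\<close>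

text \<open>The value \<open>S (D i)\<close> is forced: the map sending a \<otimes> b to
  \<open>S a\<close> times b must send D \<otimes> 1 + s \<otimes> D to 0, hence S(D) = - s D. For a
  single generator, everything about S rests on the identity s D s = 1 - s - D, a rewriting of the
  third rank one relation: it makes - s D idempotent, gives the mixed relation in the opposite ring,
  and determines the square of S. No basis of the algebra is used, so nothing is computed in
  coordinates. Every map leaves a quotient and exists because a map on representatives kills the
  relators; every identity is proved by induction over what generates its domain, namely monoid
  elements, pure tensors, or the generators s and D. The lift of a \<otimes> b to \<open>S a\<close>
  times b is additive but not multiplicative. The antipode laws are nevertheless closed under
  products, because the law for one factor says that a certain value is an integer multiple of 1,
  and such multiples are central.\<close>

definition lin_ext :: "('c, 'e) ring_scheme \<Rightarrow> ('a \<Rightarrow> 'c) \<Rightarrow> ('a \<Rightarrow>\<^sub>0 int) \<Rightarrow> 'c" where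
  "lin_ext C f p = (\<Oplus>\<^bsub>C\<^esub>k\<in>Poly_Mapping.keys p. [Poly_Mapping.lookup p k] \<cdot>\<^bsub>C\<^esub> f k)"

text \<open>The sum inside \<open>tensor_lift\<close> is isolated as \<open>lin_ext\<close>, indexed
  by an arbitrary type: the same facts then serve tensors, indexed by pairs, and the free algebra,
  indexed by words.\<close>

lemma tensor_lift_eq: "tensor_lift C \<beta> X = the_elem (lin_ext C (\<lambda>k. \<beta> (fst k) (snd k)) ` X)"
  by (simp add: tensor_lift_def lin_ext_def)

context abelian_group
begin

text \<open>Coefficients vanish off the support. Additivity needs the larger index set, since
  cancellation can make the support of a sum smaller than the union of the supports.\<close>

lemma lin_ext_superset:
  assumes "finite F" "Poly_Mapping.keys p \<subseteq> F" "f \<in> F \<rightarrow> carrier G"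
  shows "lin_ext G f p = (\<Oplus>k\<in>F. [Poly_Mapping.lookup p k] \<cdot> f k)"
  unfolding lin_ext_def
proof (rule add.finprod_mono_neutral_cong_left)
  fix i assume "i \<in> F - Poly_Mapping.keys p"
  then show "[Poly_Mapping.lookup p i] \<cdot> f i = \<zero>"
    by (simp add: in_keys_iff add_pow_def)
qed (use assms in auto)

lemma lin_ext_add:
  assumes "f \<in> S \<rightarrow> carrier G" "Poly_Mapping.keys p \<subseteq> S" "Poly_Mapping.keys q \<subseteq> S"
  shows "lin_ext G f (p + q) = lin_ext G f p \<oplus> lin_ext G f q"
proof -
  let ?F = "Poly_Mapping.keys p \<union> Poly_Mapping.keys q"
  have f: "f \<in> ?F \<rightarrow> carrier G"
    using assms by auto
  have "lin_ext G f (p + q) = (\<Oplus>k\<in>?F. [Poly_Mapping.lookup (p + q) k] \<cdot> f k)"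
    by (rule lin_ext_superset) (use f keys_add[of p q] in auto)
  also have "\<dots> = (\<Oplus>k\<in>?F. [Poly_Mapping.lookup p k] \<cdot> f k \<oplus> [Poly_Mapping.lookup q k] \<cdot> f k)"
    by (rule add.finprod_cong') (use f in \<open>auto simp: lookup_add Pi_iff add.int_pow_mult\<close>)
  also have "\<dots> = (\<Oplus>k\<in>?F. [Poly_Mapping.lookup p k] \<cdot> f k) \<oplus> (\<Oplus>k\<in>?F. [Poly_Mapping.lookup q k] \<cdot> f k)"
    by (rule add.finprod_multf) (use f in auto)
  also have "\<dots> = lin_ext G f p \<oplus> lin_ext G f q"
    using lin_ext_superset[of ?F p f] lin_ext_superset[of ?F q f] f by simp
  finally show ?thesis .
qed

lemma lin_ext_closed:
  assumes "f \<in> S \<rightarrow> carrier G" "Poly_Mapping.keys p \<subseteq> S"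
  shows "lin_ext G f p \<in> carrier G"
  unfolding lin_ext_def using assms by (intro add.finprod_closed) auto

lemma lin_ext_frag_of [simp]: "f x \<in> carrier G \<Longrightarrow> lin_ext G f (frag_of x) = f x"
  by (subst lin_ext_superset[of "{x}"]) (auto simp: add.int_pow_1)

end

section \<open>Monoid rings\<close>

lemma carrier_monoid_ring: "p \<in> carrier (monoid_ring M) \<longleftrightarrow> Poly_Mapping.keys p \<subseteq> carrier M"
  by (simp add: monoid_ring_def)

lemma frag_of_in_monoid_ring [simp]: "frag_of x \<in> carrier (monoid_ring M) \<longleftrightarrow> x \<in> carrier M"
  by (simp add: carrier_monoid_ring)

lemma zero_monoid_ring [simp]: "\<zero>\<^bsub>monoid_ring M\<^esub> = 0"
  by (simp add: monoid_ring_def)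

lemma one_monoid_ring: "\<one>\<^bsub>monoid_ring M\<^esub> = frag_of \<one>\<^bsub>M\<^esub>"
  by (simp add: monoid_ring_def)

lemma add_monoid_ring [simp]: "p \<oplus>\<^bsub>monoid_ring M\<^esub> q = p + q"
  by (simp add: monoid_ring_def)

lemma mult_monoid_ring_frag_of [simp]:
  "frag_of x \<otimes>\<^bsub>monoid_ring M\<^esub> frag_of y = frag_of (x \<otimes>\<^bsub>M\<^esub> y)"
  by (simp add: monoid_ring_def)

text \<open>Distributivity is stated for subtraction first because \<open>monoid_ring_induct\<close>
  builds elements by differences, which covers sums and negatives in a single case.\<close>

lemma mult_monoid_ring_diff:
  "(p - p') \<otimes>\<^bsub>monoid_ring M\<^esub> q = p \<otimes>\<^bsub>monoid_ring M\<^esub> q - p' \<otimes>\<^bsub>monoid_ring M\<^esub> q"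
  "p \<otimes>\<^bsub>monoid_ring M\<^esub> (q - q') = p \<otimes>\<^bsub>monoid_ring M\<^esub> q - p \<otimes>\<^bsub>monoid_ring M\<^esub> q'"
proof -
  have cmul: "frag_cmul c (a - b) = frag_cmul c a - frag_cmul c b" for c and a b :: "'a \<Rightarrow>\<^sub>0 int"
    by (simp add: poly_mapping_eqI lookup_minus right_diff_distrib)
  \<comment> \<open>The right factor of a product sits inside the function that the outer
    \<open>frag_extend\<close> sums, so distributivity on the right is linearity in that
    function.\<close>
  have extend: "frag_extend (\<lambda>x. f x - g x) a = frag_extend f a - frag_extend g a"
    for a :: "'a \<Rightarrow>\<^sub>0 int" and f g :: "'a \<Rightarrow> 'a \<Rightarrow>\<^sub>0 int"
    by (simp add: frag_extend_def cmul sum_subtractf)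
  show "(p - p') \<otimes>\<^bsub>monoid_ring M\<^esub> q = p \<otimes>\<^bsub>monoid_ring M\<^esub> q - p' \<otimes>\<^bsub>monoid_ring M\<^esub> q"
    "p \<otimes>\<^bsub>monoid_ring M\<^esub> (q - q') = p \<otimes>\<^bsub>monoid_ring M\<^esub> q - p \<otimes>\<^bsub>monoid_ring M\<^esub> q'"
    by (simp_all add: monoid_ring_def frag_extend_diff extend)
qed

lemma mult_monoid_ring_zero:
  "0 \<otimes>\<^bsub>monoid_ring M\<^esub> q = 0" "p \<otimes>\<^bsub>monoid_ring M\<^esub> 0 = 0"
  using mult_monoid_ring_diff(1)[of M 0 0 q] mult_monoid_ring_diff(2)[of M p 0 0] by simp_all

lemma mult_monoid_ring_add:
  "(p + p') \<otimes>\<^bsub>monoid_ring M\<^esub> q = p \<otimes>\<^bsub>monoid_ring M\<^esub> q + p' \<otimes>\<^bsub>monoid_ring M\<^esub> q"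
  "p \<otimes>\<^bsub>monoid_ring M\<^esub> (q + q') = p \<otimes>\<^bsub>monoid_ring M\<^esub> q + p \<otimes>\<^bsub>monoid_ring M\<^esub> q'"
  using mult_monoid_ring_diff(1)[of M "p + p'" p' q] mult_monoid_ring_diff(2)[of M p "q + q'" q']
  by (simp_all add: algebra_simps)

lemma monoid_ring_induct [consumes 1, case_names zero diff frag_of]:
  assumes "p \<in> carrier (monoid_ring M)"
    and "P 0"
    and "\<And>p q. p \<in> carrier (monoid_ring M) \<Longrightarrow> q \<in> carrier (monoid_ring M) \<Longrightarrow> P p \<Longrightarrow> P q \<Longrightarrow> P (p - q)"
    and "\<And>x. x \<in> carrier M \<Longrightarrow> P (frag_of x)"
  shows "P p"
  by (rule free_Abelian_group_induct[where S = "carrier M"])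
    (use assms in \<open>auto simp: carrier_monoid_ring\<close>)

lemma monoid_ring_diff_closed:
  "p \<in> carrier (monoid_ring M) \<Longrightarrow> q \<in> carrier (monoid_ring M) \<Longrightarrow> p - q \<in> carrier (monoid_ring M)"
  using keys_diff[of p q] by (auto simp: carrier_monoid_ring)

lemma (in monoid) monoid_ring_mult_closed:
  assumes "p \<in> carrier (monoid_ring G)" "q \<in> carrier (monoid_ring G)"
  shows "p \<otimes>\<^bsub>monoid_ring G\<^esub> q \<in> carrier (monoid_ring G)"
  using assms
proof (induction p rule: monoid_ring_induct)
  case (frag_of x)
  from frag_of(2,1) show ?case
    by (induction q rule: monoid_ring_induct)
      (auto simp: mult_monoid_ring_zero mult_monoid_ring_diff monoid_ring_diff_closed carrier_monoid_ring[of 0])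
qed (auto simp: mult_monoid_ring_zero mult_monoid_ring_diff monoid_ring_diff_closed carrier_monoid_ring[of 0])

lemma (in monoid) ring_monoid_ring: "ring (monoid_ring G)"
proof (rule ringI)
  show "abelian_group (monoid_ring G)"
  proof (rule abelian_groupI)
    fix p assume "p \<in> carrier (monoid_ring G)"
    then show "\<exists>q\<in>carrier (monoid_ring G). q \<oplus>\<^bsub>monoid_ring G\<^esub> p = \<zero>\<^bsub>monoid_ring G\<^esub>"
      by (intro bexI[of _ "- p"]) (auto simp: carrier_monoid_ring)
  next
    fix p q assume "p \<in> carrier (monoid_ring G)" "q \<in> carrier (monoid_ring G)"
    then show "p \<oplus>\<^bsub>monoid_ring G\<^esub> q \<in> carrier (monoid_ring G)"
      using keys_add[of p q] by (auto simp: carrier_monoid_ring)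
  qed (auto simp: carrier_monoid_ring algebra_simps)
  show "Group.monoid (monoid_ring G)"
  proof (rule monoidI)
    fix p q r assume p: "p \<in> carrier (monoid_ring G)" and q: "q \<in> carrier (monoid_ring G)"
      and r: "r \<in> carrier (monoid_ring G)"
    \<comment> \<open>Both sides are additive in each of the three arguments, so one induction per
      argument reduces the claim to associativity of \<open>G\<close>.\<close>
    from p show "p \<otimes>\<^bsub>monoid_ring G\<^esub> q \<otimes>\<^bsub>monoid_ring G\<^esub> r = p \<otimes>\<^bsub>monoid_ring G\<^esub> (q \<otimes>\<^bsub>monoid_ring G\<^esub> r)"
    proof (induction p rule: monoid_ring_induct)
      case (frag_of x)
      from q show ?case
      proof (induction q rule: monoid_ring_induct)
        case (frag_of y)
        from r show ?case
          by (induction r rule: monoid_ring_induct)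
            (use \<open>x \<in> carrier G\<close> \<open>y \<in> carrier G\<close> in
              \<open>auto simp: mult_monoid_ring_zero mult_monoid_ring_diff m_assoc\<close>)
      qed (auto simp: mult_monoid_ring_zero mult_monoid_ring_diff)
    qed (auto simp: mult_monoid_ring_zero mult_monoid_ring_diff)
  next
    fix p assume p: "p \<in> carrier (monoid_ring G)"
    then show "\<one>\<^bsub>monoid_ring G\<^esub> \<otimes>\<^bsub>monoid_ring G\<^esub> p = p"
      by (induction p rule: monoid_ring_induct)
        (auto simp: mult_monoid_ring_zero mult_monoid_ring_diff one_monoid_ring)
    from p show "p \<otimes>\<^bsub>monoid_ring G\<^esub> \<one>\<^bsub>monoid_ring G\<^esub> = p"
      by (induction p rule: monoid_ring_induct)
        (auto simp: mult_monoid_ring_zero mult_monoid_ring_diff one_monoid_ring)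
  qed (auto simp: monoid_ring_mult_closed one_monoid_ring)
qed (auto simp: mult_monoid_ring_add)

lemma (in monoid) uminus_monoid_ring:
  assumes "p \<in> carrier (monoid_ring G)"
  shows "\<ominus>\<^bsub>monoid_ring G\<^esub> p = - p"
proof -
  interpret R: ring "monoid_ring G" by (rule ring_monoid_ring)
  show ?thesis
    by (rule R.minus_equality) (use assms in \<open>auto simp: carrier_monoid_ring\<close>)
qed

lemma (in monoid) minus_monoid_ring:
  assumes "p \<in> carrier (monoid_ring G)" "q \<in> carrier (monoid_ring G)"
  shows "p \<ominus>\<^bsub>monoid_ring G\<^esub> q = p - q"
  using assms by (simp add: a_minus_def uminus_monoid_ring)

lemma add_homI:
  assumes "\<And>x. x \<in> carrier A \<Longrightarrow> h x \<in> carrier C"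
    and "\<And>x y. x \<in> carrier A \<Longrightarrow> y \<in> carrier A \<Longrightarrow> h (x \<oplus>\<^bsub>A\<^esub> y) = h x \<oplus>\<^bsub>C\<^esub> h y"
  shows "h \<in> hom (add_monoid A) (add_monoid C)"
  using assms by (auto intro!: homI)

lemma ring_hom_imp_add_hom:
  "h \<in> ring_hom A C \<Longrightarrow> h \<in> hom (add_monoid A) (add_monoid C)"
  by (auto intro!: add_homI simp: ring_hom_closed ring_hom_add)

lemma abelian_group_homI':
  assumes "ring A" "ring C" "h \<in> hom (add_monoid A) (add_monoid C)"
  shows "abelian_group_hom A C h"
  using assms
  by (auto intro!: abelian_group_homI group_hom.intro abelian_group.a_group ring.is_abelian_group
      simp: group_hom_axioms_def)

lemma (in monoid) lin_ext_hom:
  assumes "ring R" "f \<in> carrier G \<rightarrow> carrier R"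
  shows "lin_ext R f \<in> hom (add_monoid (monoid_ring G)) (add_monoid R)"
proof -
  interpret R: ring R by fact
  show ?thesis
    by (rule add_homI)
      (use R.lin_ext_closed[OF assms(2)] R.lin_ext_add[OF assms(2)] in \<open>auto simp: carrier_monoid_ring\<close>)
qed

lemma (in monoid) monoid_ring_hom_diff:
  assumes "abelian_group_hom (monoid_ring G) R h"
    and "p \<in> carrier (monoid_ring G)" "q \<in> carrier (monoid_ring G)"
  shows "h (p - q) = h p \<ominus>\<^bsub>R\<^esub> h q"
proof -
  interpret h: abelian_group_hom "monoid_ring G" R h by fact
  have "h (p - q) = h (p \<ominus>\<^bsub>monoid_ring G\<^esub> q)"
    using assms(2,3) by (simp add: minus_monoid_ring)
  then show ?thesis
    using assms(2,3) by (simp add: a_minus_def del: add_monoid_ring)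
qed

text \<open>The universal property of the monoid ring. Both sides of multiplicativity are
  biadditive, so two nested inductions reduce it to products of monoid elements.\<close>

lemma (in monoid) lin_ext_ring_hom:
  assumes "ring R" "f \<in> carrier G \<rightarrow> carrier R"
    and mult: "\<And>x y. x \<in> carrier G \<Longrightarrow> y \<in> carrier G \<Longrightarrow> f (x \<otimes> y) = f x \<otimes>\<^bsub>R\<^esub> f y"
    and one: "f \<one> = \<one>\<^bsub>R\<^esub>"
  shows "lin_ext R f \<in> ring_hom (monoid_ring G) R"
proof -
  interpret R: ring R by fact
  interpret M: ring "monoid_ring G" by (rule ring_monoid_ring)
  interpret h: abelian_group_hom "monoid_ring G" R "lin_ext R f"
    by (rule abelian_group_homI'[OF M.ring_axioms R.ring_axioms lin_ext_hom[OF assms(1,2)]])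
  note hom_diff = monoid_ring_hom_diff[OF h.abelian_group_hom_axioms]
  have z: "lin_ext R f 0 = \<zero>\<^bsub>R\<^esub>"
    using h.hom_zero by simp
  have f[simp]: "f x \<in> carrier R" if "x \<in> carrier G" for x
    using that assms by auto
  have "lin_ext R f (p \<otimes>\<^bsub>monoid_ring G\<^esub> q) = lin_ext R f p \<otimes>\<^bsub>R\<^esub> lin_ext R f q"
    if p: "p \<in> carrier (monoid_ring G)" and q: "q \<in> carrier (monoid_ring G)" for p q
    using p
  proof (induction p rule: monoid_ring_induct)
    case (frag_of x)
    from q show ?case
    proof (induction q rule: monoid_ring_induct)
      case (diff p q)
      then show ?case
        using frag_of
        by (simp add: mult_monoid_ring_diff hom_diff monoid_ring_mult_closed R.minus_eq R.r_distr R.r_minus)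
    qed (use frag_of in \<open>auto simp: mult mult_monoid_ring_zero z\<close>)
  next
    case (diff p p')
    then show ?case
      using q by (simp add: mult_monoid_ring_diff hom_diff monoid_ring_mult_closed R.minus_eq R.l_distr R.l_minus)
  qed (use q in \<open>auto simp: mult_monoid_ring_zero z\<close>)
  then show ?thesis
    by (intro ring_hom_memI) (auto simp: one_monoid_ring one simp del: add_monoid_ring)
qed

section \<open>Maps out of quotients\<close>

text \<open>A map killing the subgroup is constant on its cosets, so its image of a coset is a
  singleton. This justifies \<open>the_elem\<close> as the value of an induced map.\<close>

lemma (in abelian_subgroup) the_elem_image_coset:
  assumes "abelian_group_hom G C h" "\<And>x. x \<in> H \<Longrightarrow> h x = \<zero>\<^bsub>C\<^esub>" "x \<in> carrier G"
  shows "the_elem (h ` (H +> x)) = h x"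
proof -
  interpret h: abelian_group_hom G C h by fact
  have "h y = h x" if "y \<in> H +> x" for y
    using that assms(2,3) by (auto simp: a_r_coset_def')
  moreover have "x \<in> H +> x"
    using assms(3) by (rule a_rcos_self)
  ultimately have "h ` (H +> x) = {h x}"
    by blast
  then show ?thesis
    by simp
qed

lemma (in ideal) carrier_FactRing: "carrier (R Quot I) = (\<lambda>x. I +> x) ` carrier R"
  by (auto simp: FactRing_simps)

text \<open>The additive version stands beside the ring version because the two lifts in the
  antipode laws are additive without being multiplicative.\<close>

lemma (in ideal) quotient_lift_add_hom:
  assumes "ring C" "h \<in> hom (add_monoid R) (add_monoid C)" "\<And>x. x \<in> I \<Longrightarrow> h x = \<zero>\<^bsub>C\<^esub>"
  shows "(\<lambda>X. the_elem (h ` X)) \<in> hom (add_monoid (R Quot I)) (add_monoid C)"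
proof -
  interpret h: abelian_group_hom R C h
    by (rule abelian_group_homI'[OF ring_axioms assms(1,2)])
  have h: "the_elem (h ` (I +> x)) = h x" if "x \<in> carrier R" for x
    using the_elem_image_coset[OF h.abelian_group_hom_axioms assms(3) that] .
  show ?thesis
    by (rule add_homI)
      (auto simp: carrier_FactRing h simp flip: ring_hom_add[OF rcos_ring_hom])
qed

lemma (in ideal) quotient_lift_ring_hom:
  assumes "ring C" "h \<in> ring_hom R C" "\<And>x. x \<in> I \<Longrightarrow> h x = \<zero>\<^bsub>C\<^esub>"
  shows "(\<lambda>X. the_elem (h ` X)) \<in> ring_hom (R Quot I) C"
proof -
  interpret h: abelian_group_hom R C h
    by (rule abelian_group_homI'[OF ring_axioms assms(1) ring_hom_imp_add_hom[OF assms(2)]])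
  have h: "the_elem (h ` (I +> x)) = h x" if "x \<in> carrier R" for x
    using the_elem_image_coset[OF h.abelian_group_hom_axioms assms(3) that] .
  show ?thesis
    by (rule ring_hom_memI)
      (auto simp: carrier_FactRing h ring_hom_mult[OF assms(2)] ring_hom_one[OF assms(2)]
        simp flip: ring_hom_add[OF rcos_ring_hom] ring_hom_mult[OF rcos_ring_hom] ring_hom_one[OF rcos_ring_hom])
qed

section \<open>The tensor product ring\<close>

locale two_rings = A: ring A + B: ring B for A (structure) and B (structure)
begin

sublocale AB: monoid "A \<times>\<times> B"
  by (rule DirProd_monoid) (rule A.monoid_axioms B.monoid_axioms)+

sublocale M: ring "monoid_ring (A \<times>\<times> B)"
  by (rule AB.ring_monoid_ring)

lemma tensor_relators_carrier: "tensor_relators A B \<subseteq> carrier (monoid_ring (A \<times>\<times> B))"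
  by (auto simp: tensor_relators_def intro!: monoid_ring_diff_closed)

lemma additive_subgroup_tensor_kernel: "additive_subgroup (tensor_kernel A B) (monoid_ring (A \<times>\<times> B))"
  unfolding tensor_kernel_def
  by (rule additive_subgroupI, rule M.add.generate_is_subgroup)
    (use tensor_relators_carrier in simp)

text \<open>By distributivity, multiplying each entry of a biadditivity relator by a fixed pair
  gives a relator of the same shape. Hence the additive span of the relators absorbs products from
  both sides.\<close>

lemma tensor_relators_mult:
  assumes "r \<in> tensor_relators A B" "x \<in> carrier (A \<times>\<times> B)"
  shows "frag_of x \<otimes>\<^bsub>monoid_ring (A \<times>\<times> B)\<^esub> r \<in> tensor_relators A B"
    "r \<otimes>\<^bsub>monoid_ring (A \<times>\<times> B)\<^esub> frag_of x \<in> tensor_relators A B"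
proof -
  obtain c d where x: "x = (c, d)" "c \<in> carrier A" "d \<in> carrier B"
    using assms(2) by auto
  from assms(1) consider
    a a' b where "r = frag_of (a \<oplus>\<^bsub>A\<^esub> a', b) - frag_of (a, b) - frag_of (a', b)"
      "a \<in> carrier A" "a' \<in> carrier A" "b \<in> carrier B"
  | a b b' where "r = frag_of (a, b \<oplus>\<^bsub>B\<^esub> b') - frag_of (a, b) - frag_of (a, b')"
      "a \<in> carrier A" "b \<in> carrier B" "b' \<in> carrier B"
    unfolding tensor_relators_def by blast
  then have "frag_of x \<otimes>\<^bsub>monoid_ring (A \<times>\<times> B)\<^esub> r \<in> tensor_relators A B \<and>
    r \<otimes>\<^bsub>monoid_ring (A \<times>\<times> B)\<^esub> frag_of x \<in> tensor_relators A B"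
  proof cases
    case 1
    have "frag_of x \<otimes>\<^bsub>monoid_ring (A \<times>\<times> B)\<^esub> r =
        frag_of (c \<otimes>\<^bsub>A\<^esub> a \<oplus>\<^bsub>A\<^esub> c \<otimes>\<^bsub>A\<^esub> a', d \<otimes>\<^bsub>B\<^esub> b) - frag_of (c \<otimes>\<^bsub>A\<^esub> a, d \<otimes>\<^bsub>B\<^esub> b) - frag_of (c \<otimes>\<^bsub>A\<^esub> a', d \<otimes>\<^bsub>B\<^esub> b)"
      "r \<otimes>\<^bsub>monoid_ring (A \<times>\<times> B)\<^esub> frag_of x =
        frag_of (a \<otimes>\<^bsub>A\<^esub> c \<oplus>\<^bsub>A\<^esub> a' \<otimes>\<^bsub>A\<^esub> c, b \<otimes>\<^bsub>B\<^esub> d) - frag_of (a \<otimes>\<^bsub>A\<^esub> c, b \<otimes>\<^bsub>B\<^esub> d) - frag_of (a' \<otimes>\<^bsub>A\<^esub> c, b \<otimes>\<^bsub>B\<^esub> d)"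
      using 1 x by (simp_all add: mult_monoid_ring_diff A.l_distr A.r_distr)
    moreover have "c \<otimes>\<^bsub>A\<^esub> a \<in> carrier A" "c \<otimes>\<^bsub>A\<^esub> a' \<in> carrier A" "d \<otimes>\<^bsub>B\<^esub> b \<in> carrier B"
      "a \<otimes>\<^bsub>A\<^esub> c \<in> carrier A" "a' \<otimes>\<^bsub>A\<^esub> c \<in> carrier A" "b \<otimes>\<^bsub>B\<^esub> d \<in> carrier B"
      using 1 x by simp_all
    ultimately show ?thesis
      unfolding tensor_relators_def by blast
  next
    case 2
    have "frag_of x \<otimes>\<^bsub>monoid_ring (A \<times>\<times> B)\<^esub> r =
        frag_of (c \<otimes>\<^bsub>A\<^esub> a, d \<otimes>\<^bsub>B\<^esub> b \<oplus>\<^bsub>B\<^esub> d \<otimes>\<^bsub>B\<^esub> b') - frag_of (c \<otimes>\<^bsub>A\<^esub> a, d \<otimes>\<^bsub>B\<^esub> b) - frag_of (c \<otimes>\<^bsub>A\<^esub> a, d \<otimes>\<^bsub>B\<^esub> b')"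
      "r \<otimes>\<^bsub>monoid_ring (A \<times>\<times> B)\<^esub> frag_of x =
        frag_of (a \<otimes>\<^bsub>A\<^esub> c, b \<otimes>\<^bsub>B\<^esub> d \<oplus>\<^bsub>B\<^esub> b' \<otimes>\<^bsub>B\<^esub> d) - frag_of (a \<otimes>\<^bsub>A\<^esub> c, b \<otimes>\<^bsub>B\<^esub> d) - frag_of (a \<otimes>\<^bsub>A\<^esub> c, b' \<otimes>\<^bsub>B\<^esub> d)"
      using 2 x by (simp_all add: mult_monoid_ring_diff B.l_distr B.r_distr)
    moreover have "c \<otimes>\<^bsub>A\<^esub> a \<in> carrier A" "d \<otimes>\<^bsub>B\<^esub> b' \<in> carrier B" "d \<otimes>\<^bsub>B\<^esub> b \<in> carrier B"
      "a \<otimes>\<^bsub>A\<^esub> c \<in> carrier A" "b' \<otimes>\<^bsub>B\<^esub> d \<in> carrier B" "b \<otimes>\<^bsub>B\<^esub> d \<in> carrier B"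
      using 2 x by simp_all
    ultimately show ?thesis
      unfolding tensor_relators_def by blast
  qed
  then show "frag_of x \<otimes>\<^bsub>monoid_ring (A \<times>\<times> B)\<^esub> r \<in> tensor_relators A B"
    "r \<otimes>\<^bsub>monoid_ring (A \<times>\<times> B)\<^esub> frag_of x \<in> tensor_relators A B"
    by simp_all
qed

text \<open>\<open>generate\<close> has separate cases for inverses and sums; a single case for
  differences matches the other induction rules.\<close>

lemma tensor_kernel_induct [consumes 1, case_names zero relator diff]:
  assumes "p \<in> tensor_kernel A B"
    and "P 0"
    and "\<And>r. r \<in> tensor_relators A B \<Longrightarrow> P r"
    and "\<And>p q. p \<in> tensor_kernel A B \<Longrightarrow> q \<in> tensor_kernel A B \<Longrightarrow> P p \<Longrightarrow> P q \<Longrightarrow> P (p - q)"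
  shows "P p"
proof -
  interpret K: additive_subgroup "tensor_kernel A B" "monoid_ring (A \<times>\<times> B)"
    by (rule additive_subgroup_tensor_kernel)
  have uminus: "- p \<in> tensor_kernel A B" if "p \<in> tensor_kernel A B" for p
    using K.a_inv_closed[OF that] that by (simp add: AB.uminus_monoid_ring)
  have "p \<in> tensor_kernel A B \<and> P p"
    using assms(1)[unfolded tensor_kernel_def]
  proof (induction rule: generate.induct)
    case one
    then show ?case
      using assms(2) K.zero_closed by simp
  next
    case (incl r)
    then show ?case
      using assms(3) by (auto simp: tensor_kernel_def intro: generate.incl)
  next
    case (inv r)
    then have r: "r \<in> carrier (monoid_ring (A \<times>\<times> B))"
      using tensor_relators_carrier by auto
    have "r \<in> tensor_kernel A B"
      using inv by (auto simp: tensor_kernel_def intro: generate.incl)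
    then show ?case
      using assms(4)[of 0 r] assms(2,3) inv uminus[of r] K.zero_closed AB.uminus_monoid_ring[OF r]
      by (simp add: a_inv_def)
  next
    case (eng p q)
    \<comment> \<open>The sum is reached by two differences, as \<open>p - (0 - q)\<close>.\<close>
    then show ?case
      using assms(4)[of 0 q] assms(4)[of p "- q"] assms(2) uminus[of q] K.zero_closed K.a_closed[of p q] by simp
  qed
  then show ?thesis ..
qed

lemma ideal_tensor_kernel: "ideal (tensor_kernel A B) (monoid_ring (A \<times>\<times> B))"
proof -
  interpret K: additive_subgroup "tensor_kernel A B" "monoid_ring (A \<times>\<times> B)"
    by (rule additive_subgroup_tensor_kernel)
  have diff: "p - q \<in> tensor_kernel A B" if "p \<in> tensor_kernel A B" "q \<in> tensor_kernel A B" for p q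
    using K.a_closed[OF that(1) K.a_inv_closed[OF that(2)]] that by (simp add: AB.uminus_monoid_ring)
  have relator: "r \<in> tensor_kernel A B" if "r \<in> tensor_relators A B" for r
    using that by (auto simp: tensor_kernel_def intro: generate.incl)
  have "p \<otimes>\<^bsub>monoid_ring (A \<times>\<times> B)\<^esub> k \<in> tensor_kernel A B \<and> k \<otimes>\<^bsub>monoid_ring (A \<times>\<times> B)\<^esub> p \<in> tensor_kernel A B"
    if "k \<in> tensor_kernel A B" and p: "p \<in> carrier (monoid_ring (A \<times>\<times> B))" for p k
    using that(1)
  proof (induction k rule: tensor_kernel_induct)
    case (relator r)
    from p show ?case
      by (induction p rule: monoid_ring_induct)
        (use relator K.zero_closed in \<open>auto simp: mult_monoid_ring_zero mult_monoid_ring_diff diff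
            tensor_relators_mult \<open>\<And>r. r \<in> tensor_relators A B \<Longrightarrow> r \<in> tensor_kernel A B\<close>\<close>)
  qed (use K.zero_closed in \<open>auto simp: mult_monoid_ring_zero mult_monoid_ring_diff diff\<close>)
  then show ?thesis
    by (intro idealI M.ring_axioms K.a_subgroup) auto
qed

sublocale K: ideal "tensor_kernel A B" "monoid_ring (A \<times>\<times> B)"
  by (rule ideal_tensor_kernel)

lemma ring_tensor_ring: "ring (tensor_ring A B)"
  unfolding tensor_ring_def by (rule K.quotient_is_ring)

sublocale T: ring "tensor_ring A B"
  by (rule ring_tensor_ring)

lemma coset_ring_hom:
  "(+>\<^bsub>monoid_ring (A \<times>\<times> B)\<^esub>) (tensor_kernel A B) \<in> ring_hom (monoid_ring (A \<times>\<times> B)) (tensor_ring A B)"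
  unfolding tensor_ring_def by (rule K.rcos_ring_hom)

lemma tens_closed [simp, intro]:
  "a \<in> carrier A \<Longrightarrow> b \<in> carrier B \<Longrightarrow> tens A B a b \<in> carrier (tensor_ring A B)"
  unfolding tens_def by (rule ring_hom_closed[OF coset_ring_hom]) simp

lemma tens_mult:
  assumes "a \<in> carrier A" "b \<in> carrier B" "a' \<in> carrier A" "b' \<in> carrier B"
  shows "tens A B a b \<otimes>\<^bsub>tensor_ring A B\<^esub> tens A B a' b' = tens A B (a \<otimes>\<^bsub>A\<^esub> a') (b \<otimes>\<^bsub>B\<^esub> b')"
  unfolding tens_def by (subst ring_hom_mult[OF coset_ring_hom, symmetric]) (use assms in simp_all)

lemma tens_one: "tens A B \<one>\<^bsub>A\<^esub> \<one>\<^bsub>B\<^esub> = \<one>\<^bsub>tensor_ring A B\<^esub>"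
  unfolding tens_def by (subst ring_hom_one[OF coset_ring_hom, symmetric]) (simp add: one_monoid_ring)

lemma coset_eqI:
  assumes "p \<in> carrier (monoid_ring (A \<times>\<times> B))" "q \<in> carrier (monoid_ring (A \<times>\<times> B))"
    and "p - q \<in> tensor_kernel A B"
  shows "tensor_kernel A B +>\<^bsub>monoid_ring (A \<times>\<times> B)\<^esub> p = tensor_kernel A B +>\<^bsub>monoid_ring (A \<times>\<times> B)\<^esub> q"
proof -
  have "p \<in> tensor_kernel A B +>\<^bsub>monoid_ring (A \<times>\<times> B)\<^esub> q"
    using assms K.a_rcos_module_minus[OF M.ring_axioms assms(2,1)] by (simp add: AB.minus_monoid_ring)
  then show ?thesis
    using M.a_repr_independence[OF _ assms(2) K.a_subgroup] by simp
qed

lemma tens_add_left: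
  assumes "a \<in> carrier A" "a' \<in> carrier A" "b \<in> carrier B"
  shows "tens A B (a \<oplus>\<^bsub>A\<^esub> a') b = tens A B a b \<oplus>\<^bsub>tensor_ring A B\<^esub> tens A B a' b"
proof -
  have "frag_of (a \<oplus>\<^bsub>A\<^esub> a', b) - frag_of (a, b) - frag_of (a', b) \<in> tensor_relators A B"
    using assms unfolding tensor_relators_def by blast
  then have "frag_of (a \<oplus>\<^bsub>A\<^esub> a', b) - (frag_of (a, b) + frag_of (a', b)) \<in> tensor_kernel A B"
    by (auto simp: tensor_kernel_def diff_diff_add intro: generate.incl)
  moreover have "frag_of (a, b) + frag_of (a', b) \<in> carrier (monoid_ring (A \<times>\<times> B))"
    using M.a_closed[of "frag_of (a, b)" "frag_of (a', b)"] assms by simp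
  ultimately show ?thesis
    unfolding tens_def
    by (subst ring_hom_add[OF coset_ring_hom, symmetric])
      (use assms in \<open>simp_all add: coset_eqI[where q = "_ + _"]\<close>)
qed

lemma tens_add_right:
  assumes "a \<in> carrier A" "b \<in> carrier B" "b' \<in> carrier B"
  shows "tens A B a (b \<oplus>\<^bsub>B\<^esub> b') = tens A B a b \<oplus>\<^bsub>tensor_ring A B\<^esub> tens A B a b'"
proof -
  have "frag_of (a, b \<oplus>\<^bsub>B\<^esub> b') - frag_of (a, b) - frag_of (a, b') \<in> tensor_relators A B"
    using assms unfolding tensor_relators_def by blast
  then have "frag_of (a, b \<oplus>\<^bsub>B\<^esub> b') - (frag_of (a, b) + frag_of (a, b')) \<in> tensor_kernel A B"
    by (auto simp: tensor_kernel_def diff_diff_add intro: generate.incl)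
  moreover have "frag_of (a, b) + frag_of (a, b') \<in> carrier (monoid_ring (A \<times>\<times> B))"
    using M.a_closed[of "frag_of (a, b)" "frag_of (a, b')"] assms by simp
  ultimately show ?thesis
    unfolding tens_def
    by (subst ring_hom_add[OF coset_ring_hom, symmetric])
      (use assms in \<open>simp_all add: coset_eqI[where q = "_ + _"]\<close>)
qed

lemma tens_minus_left:
  assumes "a \<in> carrier A" "a' \<in> carrier A" "b \<in> carrier B"
  shows "tens A B (a \<ominus>\<^bsub>A\<^esub> a') b = tens A B a b \<ominus>\<^bsub>tensor_ring A B\<^esub> tens A B a' b"
proof -
  interpret h: abelian_group_hom A "tensor_ring A B" "\<lambda>a. tens A B a b"
    by (rule abelian_group_homI'[OF A.ring_axioms T.ring_axioms add_homI])
      (use assms in \<open>auto simp: tens_add_left\<close>)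
  show ?thesis
    using assms by (simp add: A.minus_eq T.minus_eq)
qed

lemma tens_minus_right:
  assumes "a \<in> carrier A" "b \<in> carrier B" "b' \<in> carrier B"
  shows "tens A B a (b \<ominus>\<^bsub>B\<^esub> b') = tens A B a b \<ominus>\<^bsub>tensor_ring A B\<^esub> tens A B a b'"
proof -
  interpret h: abelian_group_hom B "tensor_ring A B" "\<lambda>b. tens A B a b"
    by (rule abelian_group_homI'[OF B.ring_axioms T.ring_axioms add_homI])
      (use assms in \<open>auto simp: tens_add_right\<close>)
  show ?thesis
    using assms by (simp add: B.minus_eq T.minus_eq)
qed

text \<open>Pure tensors span additively: every tensor is the coset of an element of the free
  abelian group, and basis elements have pure tensors as cosets. Identities between additive maps
  thus need checking on pure tensors only.\<close>

lemma tensor_induct [consumes 1, case_names zero diff tens]: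
  assumes "x \<in> carrier (tensor_ring A B)"
    and "P \<zero>\<^bsub>tensor_ring A B\<^esub>"
    and "\<And>x y. x \<in> carrier (tensor_ring A B) \<Longrightarrow> y \<in> carrier (tensor_ring A B) \<Longrightarrow> P x \<Longrightarrow> P y \<Longrightarrow>
      P (x \<ominus>\<^bsub>tensor_ring A B\<^esub> y)"
    and "\<And>a b. a \<in> carrier A \<Longrightarrow> b \<in> carrier B \<Longrightarrow> P (tens A B a b)"
  shows "P x"
proof -
  interpret h: ring_hom_ring "monoid_ring (A \<times>\<times> B)" "tensor_ring A B"
    "(+>\<^bsub>monoid_ring (A \<times>\<times> B)\<^esub>) (tensor_kernel A B)"
    by (rule ring_hom_ringI2[OF M.ring_axioms T.ring_axioms coset_ring_hom])
  obtain p where p: "p \<in> carrier (monoid_ring (A \<times>\<times> B))"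
    and x: "x = tensor_kernel A B +>\<^bsub>monoid_ring (A \<times>\<times> B)\<^esub> p"
    using assms(1) by (auto simp: tensor_ring_def K.carrier_FactRing)
  from p show ?thesis
    unfolding x
  proof (induction p rule: monoid_ring_induct)
    case zero
    then show ?case
      using h.hom_zero assms(2) by simp
  next
    case (diff p q)
    then have "tensor_kernel A B +>\<^bsub>monoid_ring (A \<times>\<times> B)\<^esub> (p \<ominus>\<^bsub>monoid_ring (A \<times>\<times> B)\<^esub> q) =
        (tensor_kernel A B +>\<^bsub>monoid_ring (A \<times>\<times> B)\<^esub> p) \<ominus>\<^bsub>tensor_ring A B\<^esub>
        (tensor_kernel A B +>\<^bsub>monoid_ring (A \<times>\<times> B)\<^esub> q)"
      unfolding a_minus_def by (simp del: add_monoid_ring)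
    then show ?case
      using assms(3)[OF h.hom_closed h.hom_closed, of p q] diff by (simp add: AB.minus_monoid_ring)
  next
    case (frag_of x)
    then show ?case
      using assms(4)[of "fst x" "snd x"] by (auto simp: tens_def)
  qed
qed

end

section \<open>Biadditive maps and their lifts to the tensor product\<close>

definition biadditive ::
  "('a, 'c) ring_scheme \<Rightarrow> ('b, 'd) ring_scheme \<Rightarrow> ('e, 'f) ring_scheme \<Rightarrow> ('a \<Rightarrow> 'b \<Rightarrow> 'e) \<Rightarrow> bool" where
  "biadditive A B C \<beta> \<longleftrightarrow>
    (\<forall>a\<in>carrier A. \<forall>b\<in>carrier B. \<beta> a b \<in> carrier C) \<and>
    (\<forall>a\<in>carrier A. \<forall>a'\<in>carrier A. \<forall>b\<in>carrier B. \<beta> (a \<oplus>\<^bsub>A\<^esub> a') b = \<beta> a b \<oplus>\<^bsub>C\<^esub> \<beta> a' b) \<and>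
    (\<forall>a\<in>carrier A. \<forall>b\<in>carrier B. \<forall>b'\<in>carrier B. \<beta> a (b \<oplus>\<^bsub>B\<^esub> b') = \<beta> a b \<oplus>\<^bsub>C\<^esub> \<beta> a b')"

locale biadditive_map = two_rings A B + C: ring C
  for A (structure) and B (structure) and C (structure) +
  fixes \<beta>
  assumes biadditive: "biadditive A B C \<beta>"
begin

lemma map_closed: "(\<lambda>k. \<beta> (fst k) (snd k)) \<in> carrier (A \<times>\<times> B) \<rightarrow> carrier C"
  using biadditive by (auto simp: biadditive_def)

lemma beta_closed [simp]: "a \<in> carrier A \<Longrightarrow> b \<in> carrier B \<Longrightarrow> \<beta> a b \<in> carrier C"
  using biadditive by (auto simp: biadditive_def)

sublocale L: abelian_group_hom "monoid_ring (A \<times>\<times> B)" C "lin_ext C (\<lambda>k. \<beta> (fst k) (snd k))"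
  by (rule abelian_group_homI'[OF M.ring_axioms C.ring_axioms AB.lin_ext_hom[OF C.ring_axioms map_closed]])

lemmas lin_ext_diff = AB.monoid_ring_hom_diff[OF L.abelian_group_hom_axioms]

lemma lin_ext_kernel:
  assumes "p \<in> tensor_kernel A B"
  shows "lin_ext C (\<lambda>k. \<beta> (fst k) (snd k)) p = \<zero>\<^bsub>C\<^esub>"
  using assms
proof (induction p rule: tensor_kernel_induct)
  case zero
  show ?case
    using L.hom_zero by simp
next
  case (diff p q)
  then show ?case
    by (simp add: lin_ext_diff K.a_Hcarr C.minus_eq)
next
  case (relator r)
  \<comment> \<open>A relator is sent to \<open>(x + y) - x - y\<close>; this is its form after
    everything has been associated to the right.\<close>
  have cancel: "x \<oplus>\<^bsub>C\<^esub> (y \<oplus>\<^bsub>C\<^esub> (\<ominus>\<^bsub>C\<^esub> x \<oplus>\<^bsub>C\<^esub> \<ominus>\<^bsub>C\<^esub> y)) = \<zero>\<^bsub>C\<^esub>"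
    if "x \<in> carrier C" "y \<in> carrier C" for x y
    using that by (simp add: C.a_assoc[symmetric] C.minus_add[symmetric] C.r_neg)
  from relator show ?case
    using biadditive unfolding biadditive_def tensor_relators_def
    by (auto simp: lin_ext_diff monoid_ring_diff_closed C.minus_eq C.a_assoc cancel)
qed

lemma tensor_lift_add_hom:
  "tensor_lift C \<beta> \<in> hom (add_monoid (tensor_ring A B)) (add_monoid C)"
  using K.quotient_lift_add_hom[OF C.ring_axioms _ lin_ext_kernel] AB.lin_ext_hom[OF C.ring_axioms map_closed]
  by (simp add: tensor_lift_eq[abs_def] tensor_ring_def)

lemma tensor_lift_tens [simp]:
  assumes "a \<in> carrier A" "b \<in> carrier B"
  shows "tensor_lift C \<beta> (tens A B a b) = \<beta> a b"
  using K.the_elem_image_coset[OF L.abelian_group_hom_axioms lin_ext_kernel, of "frag_of (a, b)"] assms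
  by (simp add: tensor_lift_eq tens_def)

sublocale lift: abelian_group_hom "tensor_ring A B" C "tensor_lift C \<beta>"
  by (rule abelian_group_homI'[OF T.ring_axioms C.ring_axioms tensor_lift_add_hom])

text \<open>The hypotheses say that the map on pairs is multiplicative on the monoid
  \<open>A \<times>\<times> B\<close>, so \<open>lin_ext_ring_hom\<close> applies and the result
  descends to the quotient.\<close>

lemma tensor_lift_ring_hom:
  assumes mult: "\<And>a a' b b'. a \<in> carrier A \<Longrightarrow> a' \<in> carrier A \<Longrightarrow> b \<in> carrier B \<Longrightarrow> b' \<in> carrier B \<Longrightarrow>
      \<beta> (a \<otimes>\<^bsub>A\<^esub> a') (b \<otimes>\<^bsub>B\<^esub> b') = \<beta> a b \<otimes>\<^bsub>C\<^esub> \<beta> a' b'"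
    and one: "\<beta> \<one>\<^bsub>A\<^esub> \<one>\<^bsub>B\<^esub> = \<one>\<^bsub>C\<^esub>"
  shows "tensor_lift C \<beta> \<in> ring_hom (tensor_ring A B) C"
proof -
  have "lin_ext C (\<lambda>k. \<beta> (fst k) (snd k)) \<in> ring_hom (monoid_ring (A \<times>\<times> B)) C"
    by (rule AB.lin_ext_ring_hom[OF C.ring_axioms map_closed]) (auto simp: mult one)
  from K.quotient_lift_ring_hom[OF C.ring_axioms this lin_ext_kernel] show ?thesis
    by (simp add: tensor_lift_eq[abs_def] tensor_ring_def)
qed

end

lemma biadditive_mapI: "ring A \<Longrightarrow> ring B \<Longrightarrow> ring C \<Longrightarrow> biadditive A B C \<beta> \<Longrightarrow> biadditive_map A B C \<beta>"
  by (simp add: biadditive_map_def two_rings_def biadditive_map_axioms_def)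

lemma
  assumes "ring A" "ring B" "ring A'" "ring B'" "f \<in> ring_hom A A'" "g \<in> ring_hom B B'"
  shows biadditive_tensor_map: "biadditive A B (tensor_ring A' B') (\<lambda>a b. tens A' B' (f a) (g b))"
    and tensor_map_ring_hom: "tensor_map A' B' f g \<in> ring_hom (tensor_ring A B) (tensor_ring A' B')"
    and tensor_map_tens: "a \<in> carrier A \<Longrightarrow> b \<in> carrier B \<Longrightarrow> tensor_map A' B' f g (tens A B a b) = tens A' B' (f a) (g b)"
proof -
  interpret T': two_rings A' B'
    using assms by (simp add: two_rings_def)
  show *: "biadditive A B (tensor_ring A' B') (\<lambda>a b. tens A' B' (f a) (g b))"
    unfolding biadditive_def using assms(5,6)
    by (simp add: ring_hom_closed ring_hom_add T'.tens_add_left T'.tens_add_right)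
  interpret biadditive_map A B "tensor_ring A' B'" "\<lambda>a b. tens A' B' (f a) (g b)"
    by (rule biadditive_mapI[OF assms(1,2) T'.ring_tensor_ring *])
  show "tensor_map A' B' f g \<in> ring_hom (tensor_ring A B) (tensor_ring A' B')"
    unfolding tensor_map_def using assms(5,6)
    by (intro tensor_lift_ring_hom)
      (simp_all add: ring_hom_closed ring_hom_mult ring_hom_one T'.tens_mult T'.tens_one)
  show "tensor_map A' B' f g (tens A B a b) = tens A' B' (f a) (g b)" if "a \<in> carrier A" "b \<in> carrier B"
    unfolding tensor_map_def using that by simp
qed

section \<open>The associativity map of tensor products as a ring homomorphism\<close>

locale three_rings = A: ring A + B: ring B + C: ring C
  for A (structure) and B (structure) and C (structure)
begin

sublocale AB: two_rings A B ..
sublocale BC: two_rings B C ..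
sublocale T: two_rings A "tensor_ring B C"
  by (simp add: two_rings_def A.ring_axioms BC.ring_tensor_ring)

text \<open>\<open>tensor_assoc\<close> lifts twice; this is the inner biadditive map, with the
  third tensor factor held as a parameter.\<close>

abbreviation (input) assoc_inner where
  "assoc_inner c \<equiv> (\<lambda>a b. tens A (tensor_ring B C) a (tens B C b c))"

lemma assoc_inner_map:
  assumes "c \<in> carrier C"
  shows "biadditive_map A B (tensor_ring A (tensor_ring B C)) (assoc_inner c)"
  using assms
  by (intro biadditive_mapI A.ring_axioms B.ring_axioms T.ring_tensor_ring)
    (simp add: biadditive_def T.tens_add_left T.tens_add_right BC.tens_add_left)

lemma assoc_inner_tens:
  assumes "a \<in> carrier A" "b \<in> carrier B" "c \<in> carrier C"
  shows "tensor_lift (tensor_ring A (tensor_ring B C)) (assoc_inner c) (tens A B a b) = assoc_inner c a b"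
  using biadditive_map.tensor_lift_tens[OF assoc_inner_map[OF assms(3)] assms(1,2)] .

text \<open>The interpretation of \<open>biadditive_map\<close> depends on \<open>c\<close>.
  Restating its facts with \<open>c\<close> as a variable lets \<open>c\<close>, \<open>c'\<close>
  and their sum or product occur together below.\<close>

lemma assoc_inner_simps:
  assumes "c \<in> carrier C" "x \<in> carrier (tensor_ring A B)"
  shows assoc_inner_zero: "tensor_lift (tensor_ring A (tensor_ring B C)) (assoc_inner c) \<zero>\<^bsub>tensor_ring A B\<^esub> =
      \<zero>\<^bsub>tensor_ring A (tensor_ring B C)\<^esub>"
    and assoc_inner_closed: "tensor_lift (tensor_ring A (tensor_ring B C)) (assoc_inner c) x
      \<in> carrier (tensor_ring A (tensor_ring B C))"
    and assoc_inner_uminus: "tensor_lift (tensor_ring A (tensor_ring B C)) (assoc_inner c) (\<ominus>\<^bsub>tensor_ring A B\<^esub> x) =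
      \<ominus>\<^bsub>tensor_ring A (tensor_ring B C)\<^esub> tensor_lift (tensor_ring A (tensor_ring B C)) (assoc_inner c) x"
    and assoc_inner_add: "y \<in> carrier (tensor_ring A B) \<Longrightarrow>
      tensor_lift (tensor_ring A (tensor_ring B C)) (assoc_inner c) (x \<oplus>\<^bsub>tensor_ring A B\<^esub> y) =
      tensor_lift (tensor_ring A (tensor_ring B C)) (assoc_inner c) x
        \<oplus>\<^bsub>tensor_ring A (tensor_ring B C)\<^esub> tensor_lift (tensor_ring A (tensor_ring B C)) (assoc_inner c) y"
proof -
  interpret biadditive_map A B "tensor_ring A (tensor_ring B C)" "assoc_inner c"
    by (rule assoc_inner_map[OF assms(1)])
  show "tensor_lift (tensor_ring A (tensor_ring B C)) (assoc_inner c) \<zero>\<^bsub>tensor_ring A B\<^esub> =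
      \<zero>\<^bsub>tensor_ring A (tensor_ring B C)\<^esub>"
    "tensor_lift (tensor_ring A (tensor_ring B C)) (assoc_inner c) x
      \<in> carrier (tensor_ring A (tensor_ring B C))"
    "tensor_lift (tensor_ring A (tensor_ring B C)) (assoc_inner c) (\<ominus>\<^bsub>tensor_ring A B\<^esub> x) =
      \<ominus>\<^bsub>tensor_ring A (tensor_ring B C)\<^esub> tensor_lift (tensor_ring A (tensor_ring B C)) (assoc_inner c) x"
    "y \<in> carrier (tensor_ring A B) \<Longrightarrow>
      tensor_lift (tensor_ring A (tensor_ring B C)) (assoc_inner c) (x \<oplus>\<^bsub>tensor_ring A B\<^esub> y) =
      tensor_lift (tensor_ring A (tensor_ring B C)) (assoc_inner c) x
        \<oplus>\<^bsub>tensor_ring A (tensor_ring B C)\<^esub> tensor_lift (tensor_ring A (tensor_ring B C)) (assoc_inner c) y"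
    using assms(2) by simp_all
qed

lemma assoc_inner_add_right:
  assumes c: "c \<in> carrier C" "c' \<in> carrier C" and x: "x \<in> carrier (tensor_ring A B)"
  shows "tensor_lift (tensor_ring A (tensor_ring B C)) (assoc_inner (c \<oplus>\<^bsub>C\<^esub> c')) x =
    tensor_lift (tensor_ring A (tensor_ring B C)) (assoc_inner c) x
      \<oplus>\<^bsub>tensor_ring A (tensor_ring B C)\<^esub> tensor_lift (tensor_ring A (tensor_ring B C)) (assoc_inner c') x"
  using x
proof (induction x rule: AB.tensor_induct)
  case (diff x y)
  then show ?case
    using c by (simp add: AB.T.minus_eq assoc_inner_add assoc_inner_uminus assoc_inner_closed
        T.T.minus_add T.T.a_ac)
qed (use c in \<open>simp_all add: assoc_inner_zero[OF _ AB.T.zero_closed] assoc_inner_tens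
    BC.tens_add_right T.tens_add_right\<close>)

text \<open>Multiplicativity of the outer map on pairs \<open>(x, c)\<close>, as
  \<open>tensor_lift_ring_hom\<close> requires. Here \<open>x\<close> and \<open>y\<close> are
  arbitrary tensors, hence the nested inductions down to pure ones.\<close>

lemma assoc_inner_mult:
  assumes c: "c \<in> carrier C" "c' \<in> carrier C"
    and x: "x \<in> carrier (tensor_ring A B)" and y: "y \<in> carrier (tensor_ring A B)"
  shows "tensor_lift (tensor_ring A (tensor_ring B C)) (assoc_inner (c \<otimes>\<^bsub>C\<^esub> c')) (x \<otimes>\<^bsub>tensor_ring A B\<^esub> y) =
    tensor_lift (tensor_ring A (tensor_ring B C)) (assoc_inner c) x
      \<otimes>\<^bsub>tensor_ring A (tensor_ring B C)\<^esub> tensor_lift (tensor_ring A (tensor_ring B C)) (assoc_inner c') y"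
  using x
proof (induction x rule: AB.tensor_induct)
  case (diff x x')
  then show ?case
    using c y by (simp add: AB.T.minus_eq AB.T.l_distr AB.T.l_minus T.T.l_distr T.T.l_minus
        assoc_inner_add assoc_inner_uminus assoc_inner_closed)
next
  case (tens a b)
  from y show ?case
  proof (induction y rule: AB.tensor_induct)
    case (diff y y')
    then show ?case
      using c tens by (simp add: AB.T.minus_eq AB.T.r_distr AB.T.r_minus T.T.r_distr T.T.r_minus
          assoc_inner_add assoc_inner_uminus assoc_inner_closed)
  qed (use c tens in \<open>simp_all add: assoc_inner_zero[OF _ AB.T.zero_closed] assoc_inner_tens
      AB.tens_mult BC.tens_mult T.tens_mult\<close>)
qed (use c y in \<open>simp_all add: assoc_inner_zero[OF _ AB.T.zero_closed] assoc_inner_closed\<close>)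

lemma biadditive_tensor_assoc:
  "biadditive_map (tensor_ring A B) C (tensor_ring A (tensor_ring B C))
    (\<lambda>x c. tensor_lift (tensor_ring A (tensor_ring B C)) (assoc_inner c) x)"
  by (intro biadditive_mapI AB.ring_tensor_ring C.ring_axioms T.ring_tensor_ring)
    (simp add: biadditive_def assoc_inner_closed assoc_inner_add assoc_inner_add_right)

lemma tensor_assoc_ring_hom:
  "tensor_assoc A B C \<in> ring_hom (tensor_ring (tensor_ring A B) C) (tensor_ring A (tensor_ring B C))"
proof -
  interpret biadditive_map "tensor_ring A B" C "tensor_ring A (tensor_ring B C)"
    "\<lambda>x c. tensor_lift (tensor_ring A (tensor_ring B C)) (assoc_inner c) x"
    by (rule biadditive_tensor_assoc)
  show ?thesis
    unfolding tensor_assoc_def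
    by (rule tensor_lift_ring_hom)
      (simp_all add: assoc_inner_mult assoc_inner_tens T.tens_one BC.tens_one flip: AB.tens_one)
qed

lemma tensor_assoc_tens:
  assumes "a \<in> carrier A" "b \<in> carrier B" "c \<in> carrier C"
  shows "tensor_assoc A B C (tens (tensor_ring A B) C (tens A B a b) c) =
    tens A (tensor_ring B C) a (tens B C b c)"
proof -
  interpret biadditive_map "tensor_ring A B" C "tensor_ring A (tensor_ring B C)"
    "\<lambda>x c. tensor_lift (tensor_ring A (tensor_ring B C)) (assoc_inner c) x"
    by (rule biadditive_tensor_assoc)
  show ?thesis
    unfolding tensor_assoc_def using assms by (simp add: assoc_inner_tens)
qed

end

section \<open>Rings satisfying the defining relations\<close>

definition list_prod :: "('a, 'b) monoid_scheme \<Rightarrow> 'a list \<Rightarrow> 'a" where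
  "list_prod M xs = foldr (\<otimes>\<^bsub>M\<^esub>) xs \<one>\<^bsub>M\<^esub>"

lemma list_prod_simps [simp]:
  "list_prod M [] = \<one>\<^bsub>M\<^esub>" "list_prod M (x # xs) = x \<otimes>\<^bsub>M\<^esub> list_prod M xs"
  by (simp_all add: list_prod_def)

lemma (in monoid) list_prod_closed [simp]:
  "set xs \<subseteq> carrier G \<Longrightarrow> list_prod G xs \<in> carrier G"
  by (induction xs) auto

lemma (in monoid) list_prod_append:
  "set xs \<subseteq> carrier G \<Longrightarrow> set ys \<subseteq> carrier G \<Longrightarrow>
    list_prod G (xs @ ys) = list_prod G xs \<otimes> list_prod G ys"
  by (induction xs) (auto simp: m_assoc)

text \<open>The two equal letters meeting in the middle cancel first. This supplies inverses of
  words in the generators s, although the ambient ring has no inversion of its own.\<close>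

lemma (in monoid) list_prod_rev_involutions:
  assumes "set xs \<subseteq> carrier G" "\<And>x. x \<in> set xs \<Longrightarrow> x \<otimes> x = \<one>"
  shows "list_prod G (rev xs) \<otimes> list_prod G xs = \<one>"
  using assms
proof (induction xs)
  case (Cons x xs)
  have "list_prod G (rev (x # xs)) \<otimes> list_prod G (x # xs) =
      list_prod G (rev xs) \<otimes> (x \<otimes> x \<otimes> list_prod G xs)"
    using Cons.prems(1) by (simp add: list_prod_append m_assoc)
  also have "\<dots> = \<one>"
    using Cons by simp
  finally show ?case .
qed simp

section \<open>Alternating words\<close>

lemma map_alt: "map f (alt n a b) = alt n (f a) (f b)"
  by (induction n arbitrary: a b) auto

lemma set_alt: "set (alt n a b) \<subseteq> {a, b}"
  by (induction n arbitrary: a b) auto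

lemma alt_append: "alt (n + k) a b = alt n a b @ (if even n then alt k a b else alt k b a)"
  by (induction n arbitrary: a b) auto

text \<open>A word of odd length ends with the letter it begins with, one of positive even length
  with the other letter.\<close>

lemma rev_alt: "rev (alt n a b) = (if even n then alt n b a else alt n a b)"
proof (induction n arbitrary: a b)
  case (Suc n)
  then show ?case
    using alt_append[of n 1 a b] alt_append[of n 1 b a] by simp
qed simp

lemma concat_replicate_alt: "concat (replicate n [a, b]) = alt (2 * n) a b"
  by (induction n) auto

text \<open>
  The relation \<open>(s\<^sub>i s\<^sub>j)\<^sup>m = 1\<close> is stated for the alternating word of length \<open>2 m\<close>, which
  splits into two braid words.
\<close>

locale hecke_hopf_data = ring R for R (structure) +
  fixes I :: "'i set" and m :: "'i \<Rightarrow> 'i \<Rightarrow> nat" and s D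
  assumes s_closed [simp]: "i \<in> I \<Longrightarrow> s i \<in> carrier R"
    and D_closed [simp]: "i \<in> I \<Longrightarrow> D i \<in> carrier R"
    and s_s: "i \<in> I \<Longrightarrow> s i \<otimes> s i = \<one>"
    and D_D: "i \<in> I \<Longrightarrow> D i \<otimes> D i = D i"
    and s_D: "i \<in> I \<Longrightarrow> s i \<otimes> D i \<oplus> D i \<otimes> s i = s i \<ominus> \<one>"
    and coxeter: "i \<in> I \<Longrightarrow> j \<in> I \<Longrightarrow> list_prod R (alt (2 * m i j) (s i) (s j)) = \<one>"
    and braid: "i \<in> I \<Longrightarrow> j \<in> I \<Longrightarrow> i \<noteq> j \<Longrightarrow> m i j \<noteq> 0 \<Longrightarrow>
      D i \<otimes> list_prod R (alt (m i j - 1) (s j) (s i)) =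
      list_prod R (alt (m i j - 1) (s j) (s i)) \<otimes> D (if even (m i j) then i else j)"
begin

lemma set_alt_closed: "i \<in> I \<Longrightarrow> j \<in> I \<Longrightarrow> set (alt n (s i) (s j)) \<subseteq> carrier R"
  using set_alt[of n "s i" "s j"] by auto

lemma list_prod_alt_inverse:
  assumes "i \<in> I" "j \<in> I"
  shows "list_prod R (rev (alt n (s i) (s j))) \<otimes> list_prod R (alt n (s i) (s j)) = \<one>"
    "list_prod R (alt n (s i) (s j)) \<otimes> list_prod R (rev (alt n (s i) (s j))) = \<one>"
proof -
  have *: "x \<otimes> x = \<one>" if "x \<in> set (alt n (s i) (s j))" for x
    using that set_alt[of n "s i" "s j"] assms s_s by auto
  show "list_prod R (rev (alt n (s i) (s j))) \<otimes> list_prod R (alt n (s i) (s j)) = \<one>"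
    by (rule list_prod_rev_involutions) (use * set_alt_closed assms in auto)
  show "list_prod R (alt n (s i) (s j)) \<otimes> list_prod R (rev (alt n (s i) (s j))) = \<one>"
    using list_prod_rev_involutions[of "rev (alt n (s i) (s j))"] * set_alt_closed assms by auto
qed

lemma coxeter_braid:
  assumes i: "i \<in> I" and j: "j \<in> I" and n: "m i j \<noteq> 0"
  shows "s i \<otimes> list_prod R (alt (m i j - 1) (s j) (s i)) =
    list_prod R (alt (m i j - 1) (s j) (s i)) \<otimes> s (if even (m i j) then i else j)"
proof -
  obtain n where m: "m i j = Suc n"
    using n not0_implies_Suc by blast
  let ?u = "alt (m i j) (s i) (s j)" and ?v = "alt (m i j) (s j) (s i)"
  have c: "set ?u \<subseteq> carrier R" "set ?v \<subseteq> carrier R" "set (alt n (s j) (s i)) \<subseteq> carrier R"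
    using i j set_alt_closed by auto
  \<comment> \<open>For either parity of \<open>m i j\<close>, the second half of the word of length
    \<open>2 * m i j\<close> is \<open>rev ?v\<close>. The Coxeter relation thus says that
    \<open>?u\<close> times the inverse of \<open>?v\<close> is 1, so both words have the same
    product.\<close>
  have "list_prod R (?u @ rev ?v) = \<one>"
    using coxeter[OF i j] alt_append[of "m i j" "m i j" "s i" "s j"] by (simp add: rev_alt mult_2 split: if_splits)
  then have uv: "list_prod R ?u \<otimes> list_prod R (rev ?v) = \<one>"
    using c by (simp add: list_prod_append)
  have "list_prod R ?u = list_prod R ?u \<otimes> (list_prod R (rev ?v) \<otimes> list_prod R ?v)"
    using c list_prod_alt_inverse[OF j i] by simp
  also have "\<dots> = list_prod R ?u \<otimes> list_prod R (rev ?v) \<otimes> list_prod R ?v"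
    using c by (simp add: m_assoc)
  also have "\<dots> = list_prod R ?v"
    using c uv by simp
  \<comment> \<open>\<open>?u\<close> begins with \<open>s i\<close>, and \<open>?v\<close> ends
    with \<open>s i\<close> or \<open>s j\<close> according to parity; without these letters both
    are the same word of length \<open>m i j - 1\<close>.\<close>
  also have "?v = alt n (s j) (s i) @ [s (if even (m i j) then i else j)]"
    using alt_append[of n 1 "s j" "s i"] m by simp
  finally show ?thesis
    using c i j m by (simp add: list_prod_append split: if_splits)
qed

text \<open>Multiply \<open>s D + D s = s - 1\<close> by \<open>s\<close> on the left and use
  \<open>s s = 1\<close>.\<close>

lemma s_D_s:
  assumes i: "i \<in> I"
  shows "s i \<otimes> D i \<otimes> s i = \<one> \<ominus> s i \<ominus> D i"
proof -
  have "s i \<otimes> D i \<otimes> s i = s i \<otimes> (s i \<otimes> D i \<oplus> D i \<otimes> s i) \<ominus> s i \<otimes> s i \<otimes> D i"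
    using i by (simp add: r_distr m_assoc minus_eq r_neg1 a_comm[of _ "s i \<otimes> (D i \<otimes> s i)"] a_assoc r_neg)
  also have "\<dots> = \<one> \<ominus> s i \<ominus> D i"
    using i by (simp add: s_D s_s minus_eq r_distr r_minus)
  finally show ?thesis .
qed

end

section \<open>The universal property\<close>

lemma monoid_free_monoid: "monoid (free_monoid X)"
  by (rule monoidI) (auto simp: free_monoid_def)

lemma ring_free_algebra: "ring (free_algebra X)"
  by (rule monoid.ring_monoid_ring[OF monoid_free_monoid])

lemma hecke_hopf_relators_carrier:
  "rank1_relators I \<union> coxeter_relators I m \<union> braid_relators I m \<subseteq> carrier (hecke_hopf_free I)"
proof -
  interpret ring "hecke_hopf_free I"
    by (rule ring_free_algebra)
  have w: "frag_of w \<in> carrier (hecke_hopf_free I)" if "set w \<subseteq> GS ` I \<union> GD ` I" for w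
    using that by (auto simp: free_monoid_def)
  have add: "p + q \<in> carrier (hecke_hopf_free I)"
    if "p \<in> carrier (hecke_hopf_free I)" "q \<in> carrier (hecke_hopf_free I)" for p q
    using a_closed[OF that] by simp
  show ?thesis
    unfolding rank1_relators_def coxeter_relators_def braid_relators_def
    by (auto simp: concat_replicate_alt intro!: monoid_ring_diff_closed w add dest!: set_alt[THEN subsetD])
qed

lemma ideal_hecke_hopf_ideal: "ideal (hecke_hopf_ideal I m) (hecke_hopf_free I)"
  unfolding hecke_hopf_ideal_def
  by (rule ring.genideal_ideal[OF ring_free_algebra hecke_hopf_relators_carrier])

lemma ring_hecke_hopf: "ring (hecke_hopf I m)"
  unfolding hecke_hopf_def by (rule ideal.quotient_is_ring[OF ideal_hecke_hopf_ideal])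

abbreviation hecke_hopf_proj :: "'i set \<Rightarrow> ('i \<Rightarrow> 'i \<Rightarrow> nat) \<Rightarrow> ('i gen list \<Rightarrow>\<^sub>0 int) \<Rightarrow> ('i gen list \<Rightarrow>\<^sub>0 int) set" where
  "hecke_hopf_proj I m \<equiv> (+>\<^bsub>hecke_hopf_free I\<^esub>) (hecke_hopf_ideal I m)"

lemma hecke_hopf_proj_hom: "hecke_hopf_proj I m \<in> ring_hom (hecke_hopf_free I) (hecke_hopf I m)"
  unfolding hecke_hopf_def by (rule ideal.rcos_ring_hom[OF ideal_hecke_hopf_ideal])

fun gen_value :: "('i \<Rightarrow> 'c) \<Rightarrow> ('i \<Rightarrow> 'c) \<Rightarrow> 'i gen \<Rightarrow> 'c" where
  "gen_value s D (GS i) = s i"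
| "gen_value s D (GD i) = D i"

lemma frag_of_word_in_carrier:
  "set w \<subseteq> GS ` I \<union> GD ` I \<Longrightarrow> frag_of w \<in> carrier (hecke_hopf_free I)"
  by (auto simp: free_monoid_def)

lemma hecke_hopf_proj_word:
  assumes "set w \<subseteq> GS ` I \<union> GD ` I"
  shows "hecke_hopf_proj I m (frag_of w) =
    list_prod (hecke_hopf I m) (map (gen_value (gen_s I m) (gen_D I m)) w)"
  using assms
proof (induction w)
  case Nil
  show ?case
    using ring_hom_one[OF hecke_hopf_proj_hom[of I m]] by (simp add: one_monoid_ring free_monoid_def)
next
  case (Cons g w)
  have "frag_of (g # w) = frag_of [g] \<otimes>\<^bsub>hecke_hopf_free I\<^esub> frag_of w"
    by (simp add: free_monoid_def)
  moreover have "hecke_hopf_proj I m (frag_of [g]) = gen_value (gen_s I m) (gen_D I m) g"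
    by (cases g) (simp_all add: gen_s_def gen_D_def)
  moreover have "frag_of [g] \<in> carrier (hecke_hopf_free I)" "frag_of w \<in> carrier (hecke_hopf_free I)"
    by (rule frag_of_word_in_carrier; use Cons.prems in simp)+
  ultimately show ?case
    using Cons by (simp add: ring_hom_mult[OF hecke_hopf_proj_hom] del: mult_monoid_ring_frag_of)
qed

lemma gen_in_carrier [simp]:
  assumes "i \<in> I"
  shows "gen_s I m i \<in> carrier (hecke_hopf I m)" "gen_D I m i \<in> carrier (hecke_hopf I m)"
  unfolding gen_s_def gen_D_def
  by (rule ring_hom_closed[OF hecke_hopf_proj_hom frag_of_word_in_carrier]; use assms in simp)+

text \<open>The premises make the elements with property \<open>P\<close> a unital subring
  containing the generators. The product case serves properties that are not equalities of
  homomorphisms, such as the antipode laws.\<close>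

lemma hecke_hopf_induct [consumes 1, case_names one diff mult s D]:
  assumes x: "x \<in> carrier (hecke_hopf I m)"
    and one: "P \<one>\<^bsub>hecke_hopf I m\<^esub>"
    and diff: "\<And>x y. x \<in> carrier (hecke_hopf I m) \<Longrightarrow> y \<in> carrier (hecke_hopf I m) \<Longrightarrow> P x \<Longrightarrow> P y \<Longrightarrow>
      P (x \<ominus>\<^bsub>hecke_hopf I m\<^esub> y)"
    and mult: "\<And>x y. x \<in> carrier (hecke_hopf I m) \<Longrightarrow> y \<in> carrier (hecke_hopf I m) \<Longrightarrow> P x \<Longrightarrow> P y \<Longrightarrow>
      P (x \<otimes>\<^bsub>hecke_hopf I m\<^esub> y)"
    and s: "\<And>i. i \<in> I \<Longrightarrow> P (gen_s I m i)"
    and D: "\<And>i. i \<in> I \<Longrightarrow> P (gen_D I m i)"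
  shows "P x"
proof -
  interpret H: ring "hecke_hopf I m"
    by (rule ring_hecke_hopf)
  interpret F: ring "hecke_hopf_free I"
    by (rule ring_free_algebra)
  interpret J: ideal "hecke_hopf_ideal I m" "hecke_hopf_free I"
    by (rule ideal_hecke_hopf_ideal)
  interpret h: ring_hom_ring "hecke_hopf_free I" "hecke_hopf I m" "hecke_hopf_proj I m"
    by (rule ring_hom_ringI2[OF F.ring_axioms H.ring_axioms hecke_hopf_proj_hom])
  have word: "list_prod (hecke_hopf I m) (map (gen_value (gen_s I m) (gen_D I m)) w) \<in> carrier (hecke_hopf I m) \<and>
      P (list_prod (hecke_hopf I m) (map (gen_value (gen_s I m) (gen_D I m)) w))"
    if "set w \<subseteq> GS ` I \<union> GD ` I" for w
    using that
  proof (induction w)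
    case (Cons g w)
    then have "gen_value (gen_s I m) (gen_D I m) g \<in> carrier (hecke_hopf I m)"
      "P (gen_value (gen_s I m) (gen_D I m) g)"
      using s D by auto
    with Cons show ?case
      using mult by simp
  qed (use one in simp)
  obtain p where p: "p \<in> carrier (hecke_hopf_free I)" and xp: "x = hecke_hopf_proj I m p"
    using x by (auto simp: hecke_hopf_def J.carrier_FactRing)
  from p show ?thesis
    unfolding xp
  proof (induction p rule: monoid_ring_induct)
    \<comment> \<open>Zero is \<open>1 - 1\<close>, so the rule has no case for it.\<close>
    case zero
    have "P \<zero>\<^bsub>hecke_hopf I m\<^esub>"
      using diff[OF H.one_closed H.one_closed one one] by (simp add: H.minus_eq H.r_neg)
    then show ?case
      using h.hom_zero by simp
  next
    case (diff p q)
    then have "hecke_hopf_proj I m (p \<ominus>\<^bsub>hecke_hopf_free I\<^esub> q) =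
        hecke_hopf_proj I m p \<ominus>\<^bsub>hecke_hopf I m\<^esub> hecke_hopf_proj I m q"
      unfolding a_minus_def by (simp del: add_monoid_ring)
    then show ?case
      using \<open>\<And>x y. _ \<Longrightarrow> _ \<Longrightarrow> P x \<Longrightarrow> P y \<Longrightarrow> P (x \<ominus>\<^bsub>hecke_hopf I m\<^esub> y)\<close>[OF h.hom_closed h.hom_closed, of p q] diff
      by (simp add: monoid.minus_monoid_ring[OF monoid_free_monoid])
  next
    case (frag_of w)
    then have "set w \<subseteq> GS ` I \<union> GD ` I"
      by (auto simp: free_monoid_def)
    then show ?case
      using word hecke_hopf_proj_word by metis
  qed
qed

lemma hecke_hopf_hom_eqI:
  assumes "ring R" "f \<in> ring_hom (hecke_hopf I m) R" "g \<in> ring_hom (hecke_hopf I m) R"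
    and "\<And>i. i \<in> I \<Longrightarrow> f (gen_s I m i) = g (gen_s I m i)"
    and "\<And>i. i \<in> I \<Longrightarrow> f (gen_D I m i) = g (gen_D I m i)"
    and "x \<in> carrier (hecke_hopf I m)"
  shows "f x = g x"
proof -
  interpret f: ring_hom_ring "hecke_hopf I m" R f
    by (rule ring_hom_ringI2[OF ring_hecke_hopf assms(1,2)])
  interpret g: ring_hom_ring "hecke_hopf I m" R g
    by (rule ring_hom_ringI2[OF ring_hecke_hopf assms(1,3)])
  from assms(6) show ?thesis
    by (induction x rule: hecke_hopf_induct) (simp_all add: assms(4,5) a_minus_def)
qed

lemma hecke_hopf_data_hecke_hopf: "hecke_hopf_data (hecke_hopf I m) I m (gen_s I m) (gen_D I m)"
proof -
  let ?J = "hecke_hopf_ideal I m"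
  let ?p = "hecke_hopf_proj I m"
  interpret H: ring "hecke_hopf I m"
    by (rule ring_hecke_hopf)
  interpret F: ring "hecke_hopf_free I"
    by (rule ring_free_algebra)
  interpret J: ideal ?J "hecke_hopf_free I"
    by (rule ideal_hecke_hopf_ideal)
  interpret h: ring_hom_ring "hecke_hopf_free I" "hecke_hopf I m" ?p
    by (rule ring_hom_ringI2[OF F.ring_axioms H.ring_axioms hecke_hopf_proj_hom])
  have relator: "r \<in> ?J" if "r \<in> rank1_relators I \<union> coxeter_relators I m \<union> braid_relators I m" for r
    unfolding hecke_hopf_ideal_def using F.genideal_self[OF hecke_hopf_relators_carrier] that by blast
  have eq: "?p a = ?p b" if "a - b \<in> ?J" "a \<in> carrier (hecke_hopf_free I)" "b \<in> carrier (hecke_hopf_free I)" for a b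
    using that F.quotient_eq_iff_same_a_r_cos[OF J.ideal_axioms that(2,3)]
    by (simp add: monoid.minus_monoid_ring[OF monoid_free_monoid])
  \<comment> \<open>All relators except the third rank one relator are differences of two words, so
    each of them becomes an equality of two products of generators.\<close>
  have word_eq: "list_prod (hecke_hopf I m) (map (gen_value (gen_s I m) (gen_D I m)) v) =
      list_prod (hecke_hopf I m) (map (gen_value (gen_s I m) (gen_D I m)) w)"
    if "frag_of v - frag_of w \<in> rank1_relators I \<union> coxeter_relators I m \<union> braid_relators I m"
      "set v \<subseteq> GS ` I \<union> GD ` I" "set w \<subseteq> GS ` I \<union> GD ` I" for v w
    using eq[OF relator[OF that(1)] frag_of_word_in_carrier[OF that(2)] frag_of_word_in_carrier[OF that(3)]] that(2,3)
    by (simp add: hecke_hopf_proj_word)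
  show ?thesis
  proof
    fix i assume i: "i \<in> I"
    show "gen_s I m i \<otimes>\<^bsub>hecke_hopf I m\<^esub> gen_s I m i = \<one>\<^bsub>hecke_hopf I m\<^esub>"
      using word_eq[of "[GS i, GS i]" "[]"] i by (auto simp: rank1_relators_def)
    show "gen_D I m i \<otimes>\<^bsub>hecke_hopf I m\<^esub> gen_D I m i = gen_D I m i"
      using word_eq[of "[GD i, GD i]" "[GD i]"] i by (auto simp: rank1_relators_def)
    have c: "frag_of [GS i, GD i] \<in> carrier (hecke_hopf_free I)" "frag_of [GD i, GS i] \<in> carrier (hecke_hopf_free I)"
      "frag_of [GS i] \<in> carrier (hecke_hopf_free I)" "frag_of [] \<in> carrier (hecke_hopf_free I)"
      by (rule frag_of_word_in_carrier; use i in simp)+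
    \<comment> \<open>This relator involves four words: it is read as a sum on one side and a
      difference on the other.\<close>
    have "frag_of [GS i, GD i] + frag_of [GD i, GS i] - (frag_of [GS i] - frag_of []) \<in> ?J"
      by (rule relator) (use i in \<open>auto simp: rank1_relators_def\<close>)
    from eq[OF this] have "?p (frag_of [GS i, GD i] \<oplus>\<^bsub>hecke_hopf_free I\<^esub> frag_of [GD i, GS i]) =
        ?p (frag_of [GS i] \<ominus>\<^bsub>hecke_hopf_free I\<^esub> frag_of [])"
      using c F.a_closed[OF c(1,2)] by (simp add: monoid.minus_monoid_ring[OF monoid_free_monoid] monoid_ring_diff_closed)
    then show "gen_s I m i \<otimes>\<^bsub>hecke_hopf I m\<^esub> gen_D I m i \<oplus>\<^bsub>hecke_hopf I m\<^esub>
        gen_D I m i \<otimes>\<^bsub>hecke_hopf I m\<^esub> gen_s I m i = gen_s I m i \<ominus>\<^bsub>hecke_hopf I m\<^esub> \<one>\<^bsub>hecke_hopf I m\<^esub>"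
      using c i hecke_hopf_proj_word[of "[GS i, GD i]" I m] hecke_hopf_proj_word[of "[GD i, GS i]" I m]
        hecke_hopf_proj_word[of "[GS i]" I m] hecke_hopf_proj_word[of "[]" I m]
      by (simp add: a_minus_def del: add_monoid_ring)
  next
    fix i j assume ij: "i \<in> I" "j \<in> I"
    have "set (alt (2 * m i j) (GS i) (GS j)) \<subseteq> GS ` I \<union> GD ` I"
      using set_alt[of _ "GS i" "GS j"] ij by blast
    then show "list_prod (hecke_hopf I m) (alt (2 * m i j) (gen_s I m i) (gen_s I m j)) = \<one>\<^bsub>hecke_hopf I m\<^esub>"
      using word_eq[of "alt (2 * m i j) (GS i) (GS j)" "[]"] ij
      by (auto simp: coxeter_relators_def map_alt concat_replicate_alt)
    assume "i \<noteq> j" "m i j \<noteq> 0"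
    let ?w = "alt (m i j - 1) (GS j) (GS i)"
    have w: "set ?w \<subseteq> GS ` I \<union> GD ` I"
      using set_alt[of _ "GS j" "GS i"] ij by blast
    have "set (alt (m i j - 1) (gen_s I m j) (gen_s I m i)) \<subseteq> carrier (hecke_hopf I m)"
      using ij by (auto dest!: set_alt[THEN subsetD])
    moreover have "frag_of (GD i # ?w) - frag_of (?w @ [GD (if even (m i j) then i else j)]) \<in> braid_relators I m"
      unfolding braid_relators_def map_alt using ij \<open>i \<noteq> j\<close> \<open>m i j \<noteq> 0\<close> by blast
    ultimately show "gen_D I m i \<otimes>\<^bsub>hecke_hopf I m\<^esub> list_prod (hecke_hopf I m) (alt (m i j - 1) (gen_s I m j) (gen_s I m i)) =
        list_prod (hecke_hopf I m) (alt (m i j - 1) (gen_s I m j) (gen_s I m i)) \<otimes>\<^bsub>hecke_hopf I m\<^esub>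
          gen_D I m (if even (m i j) then i else j)"
      using word_eq[of "GD i # ?w" "?w @ [GD (if even (m i j) then i else j)]"] ij w
      by (simp add: map_alt H.list_prod_append split: if_splits)
  qed simp_all
qed

section \<open>Evaluation of the presented algebra in a ring satisfying the relations\<close>

context hecke_hopf_data
begin

lemma gen_value_closed: "g \<in> GS ` I \<union> GD ` I \<Longrightarrow> gen_value s D g \<in> carrier R"
  by auto

definition eval_free :: "('i gen list \<Rightarrow>\<^sub>0 int) \<Rightarrow> 'a" where
  "eval_free = lin_ext R (\<lambda>w. list_prod R (map (gen_value s D) w))"

lemma map_gen_value_closed: "set w \<subseteq> GS ` I \<union> GD ` I \<Longrightarrow> set (map (gen_value s D) w) \<subseteq> carrier R"
  using gen_value_closed by fastforce

lemma eval_free_hom: "eval_free \<in> ring_hom (hecke_hopf_free I) R"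
  unfolding eval_free_def
proof (rule monoid.lin_ext_ring_hom[OF monoid_free_monoid ring_axioms])
  show "(\<lambda>w. list_prod R (map (gen_value s D) w)) \<in> carrier (free_monoid (GS ` I \<union> GD ` I)) \<rightarrow> carrier R"
    by (intro funcsetI list_prod_closed map_gen_value_closed) (auto simp: free_monoid_def)
  fix v w assume "v \<in> carrier (free_monoid (GS ` I \<union> GD ` I))" "w \<in> carrier (free_monoid (GS ` I \<union> GD ` I))"
  then have "set v \<subseteq> GS ` I \<union> GD ` I" "set w \<subseteq> GS ` I \<union> GD ` I"
    by (auto simp: free_monoid_def)
  from this[THEN map_gen_value_closed]
  show "list_prod R (map (gen_value s D) (v \<otimes>\<^bsub>free_monoid (GS ` I \<union> GD ` I)\<^esub> w)) =
      list_prod R (map (gen_value s D) v) \<otimes> list_prod R (map (gen_value s D) w)"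
    by (simp add: free_monoid_def list_prod_append)
qed (simp add: free_monoid_def)

lemma eval_free_word: "set w \<subseteq> GS ` I \<union> GD ` I \<Longrightarrow> eval_free (frag_of w) = list_prod R (map (gen_value s D) w)"
  unfolding eval_free_def by (rule lin_ext_frag_of) (rule list_prod_closed[OF map_gen_value_closed])

text \<open>The kernel of a ring homomorphism is an ideal, so by minimality of the generated ideal
  it is enough that it contains the three families of relators.\<close>

lemma eval_free_kernel:
  assumes "p \<in> hecke_hopf_ideal I m"
  shows "eval_free p = \<zero>"
proof -
  interpret F: ring "hecke_hopf_free I"
    by (rule ring_free_algebra)
  interpret h: ring_hom_ring "hecke_hopf_free I" R eval_free
    by (rule ring_hom_ringI2[OF F.ring_axioms ring_axioms eval_free_hom])
  note diff = monoid.monoid_ring_hom_diff[OF monoid_free_monoid h.abelian_group_hom_axioms]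
  have add: "eval_free (p + q) = eval_free p \<oplus> eval_free q"
    if "p \<in> carrier (hecke_hopf_free I)" "q \<in> carrier (hecke_hopf_free I)" for p q
    using h.hom_add[OF that] by simp
  have self: "x \<ominus> x = \<zero>" if "x \<in> carrier R" for x
    using that by (simp add: minus_eq r_neg)
  have words: "eval_free (frag_of v - frag_of w) = \<zero>"
    if "list_prod R (map (gen_value s D) v) = list_prod R (map (gen_value s D) w)"
      "set v \<subseteq> GS ` I \<union> GD ` I" "set w \<subseteq> GS ` I \<union> GD ` I" for v w
    using that list_prod_closed[OF map_gen_value_closed[of w]]
      diff[OF frag_of_word_in_carrier[OF that(2)] frag_of_word_in_carrier[OF that(3)]]
    by (simp add: eval_free_word self)
  have "rank1_relators I \<subseteq> a_kernel (hecke_hopf_free I) R eval_free"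
  proof -
    have c: "frag_of [GS i, GD i] \<in> carrier (hecke_hopf_free I)" "frag_of [GD i, GS i] \<in> carrier (hecke_hopf_free I)"
      "frag_of [GS i] \<in> carrier (hecke_hopf_free I)" "frag_of [] \<in> carrier (hecke_hopf_free I)" if "i \<in> I" for i
      by (rule frag_of_word_in_carrier; use that in simp)+
    have "eval_free (frag_of [GS i, GD i] + frag_of [GD i, GS i] - (frag_of [GS i] - frag_of [])) = \<zero>" if "i \<in> I" for i
      using that c[OF that] F.a_closed[OF c(1,2)[OF that]]
      by (simp add: diff add monoid_ring_diff_closed eval_free_word s_D self)
    moreover have "eval_free (frag_of [GS i, GS i] - frag_of []) = \<zero>" if "i \<in> I" for i
      by (rule words) (use that s_s in auto)
    moreover have "eval_free (frag_of [GD i, GD i] - frag_of [GD i]) = \<zero>" if "i \<in> I" for i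
      by (rule words) (use that D_D in auto)
    ultimately show ?thesis
      using hecke_hopf_relators_carrier[of I m] unfolding a_kernel_def' by (auto simp: rank1_relators_def)
  qed
  moreover have "coxeter_relators I m \<subseteq> a_kernel (hecke_hopf_free I) R eval_free"
  proof -
    have "eval_free (frag_of (alt (2 * m i j) (GS i) (GS j)) - frag_of []) = \<zero>" if "i \<in> I" "j \<in> I" for i j
      by (rule words) (use that coxeter in \<open>auto simp: map_alt dest!: set_alt[THEN subsetD]\<close>)
    then show ?thesis
      using hecke_hopf_relators_carrier[of I m]
      unfolding a_kernel_def' coxeter_relators_def concat_replicate_alt by blast
  qed
  moreover have "braid_relators I m \<subseteq> a_kernel (hecke_hopf_free I) R eval_free"
  proof -
    have "eval_free (frag_of (GD i # alt (m i j - 1) (GS j) (GS i)) -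
        frag_of (alt (m i j - 1) (GS j) (GS i) @ [GD (if even (m i j) then i else j)])) = \<zero>"
      if "i \<in> I" "j \<in> I" "i \<noteq> j" "m i j \<noteq> 0" for i j
    proof (rule words)
      have w: "set (alt (m i j - 1) (GS j) (GS i)) \<subseteq> GS ` I \<union> GD ` I"
        using set_alt[of _ "GS j" "GS i"] that by blast
      then show "set (GD i # alt (m i j - 1) (GS j) (GS i)) \<subseteq> GS ` I \<union> GD ` I"
        "set (alt (m i j - 1) (GS j) (GS i) @ [GD (if even (m i j) then i else j)]) \<subseteq> GS ` I \<union> GD ` I"
        using that by auto
      show "list_prod R (map (gen_value s D) (GD i # alt (m i j - 1) (GS j) (GS i))) =
          list_prod R (map (gen_value s D) (alt (m i j - 1) (GS j) (GS i) @ [GD (if even (m i j) then i else j)]))"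
        using braid[OF that] that set_alt_closed[of j i] by (simp add: map_alt list_prod_append split: if_splits)
    qed
    moreover have "braid_relators I m \<subseteq> carrier (hecke_hopf_free I)"
      using hecke_hopf_relators_carrier[of I m] by blast
    ultimately show ?thesis
      unfolding a_kernel_def' braid_relators_def map_alt by blast
  qed
  ultimately have "hecke_hopf_ideal I m \<subseteq> a_kernel (hecke_hopf_free I) R eval_free"
    unfolding hecke_hopf_ideal_def by (intro F.genideal_minimal h.kernel_is_ideal) simp
  from subsetD[OF this assms] show ?thesis
    unfolding a_kernel_def' mem_Collect_eq by (rule conjunct2)
qed

text \<open>The existence half of the universal property; \<open>hecke_hopf_hom_eqI\<close> is the
  uniqueness half.\<close>

lemma hecke_hopf_universal:
  "\<exists>h \<in> ring_hom (hecke_hopf I m) R. \<forall>i\<in>I. h (gen_s I m i) = s i \<and> h (gen_D I m i) = D i"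
proof (intro bexI ballI conjI)
  interpret J: ideal "hecke_hopf_ideal I m" "hecke_hopf_free I"
    by (rule ideal_hecke_hopf_ideal)
  interpret h: ring_hom_ring "hecke_hopf_free I" R eval_free
    by (rule ring_hom_ringI2[OF ring_free_algebra ring_axioms eval_free_hom])
  let ?h = "\<lambda>X. the_elem (eval_free ` X)"
  show "?h \<in> ring_hom (hecke_hopf I m) R"
    unfolding hecke_hopf_def by (rule J.quotient_lift_ring_hom[OF ring_axioms eval_free_hom eval_free_kernel])
  have h: "?h (hecke_hopf_proj I m p) = eval_free p" if "p \<in> carrier (hecke_hopf_free I)" for p
    by (rule J.the_elem_image_coset[OF h.abelian_group_hom_axioms eval_free_kernel that])
  show "?h (gen_s I m i) = s i" "?h (gen_D I m i) = D i" if "i \<in> I" for i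
    using that h[OF frag_of_word_in_carrier[of "[GS i]" I]] h[OF frag_of_word_in_carrier[of "[GD i]" I]]
    by (simp_all add: gen_s_def gen_D_def eval_free_word)
qed

end

section \<open>Comultiplication, counit and antipode\<close>

text \<open>At s = 1 and D = 0 every relation becomes 1 = 1 or 0 = 0. This yields the
  counit.\<close>

lemma hecke_hopf_data_int: "hecke_hopf_data \<Z> I m (\<lambda>_. 1) (\<lambda>_. 0)"
proof -
  have "list_prod \<Z> (alt n 1 1) = 1" for n
    by (induction n) auto
  then show ?thesis
    by (intro hecke_hopf_data.intro int.ring_axioms hecke_hopf_data_axioms.intro) (auto simp: int_a_minus_eq)
qed

section \<open>The relations in the opposite ring and in the tensor square\<close>

lemma opposite_ring_simps [simp]:
  "carrier (opposite_ring R) = carrier R" "x \<otimes>\<^bsub>opposite_ring R\<^esub> y = y \<otimes>\<^bsub>R\<^esub> x"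
  "\<one>\<^bsub>opposite_ring R\<^esub> = \<one>\<^bsub>R\<^esub>" "\<zero>\<^bsub>opposite_ring R\<^esub> = \<zero>\<^bsub>R\<^esub>"
  "x \<oplus>\<^bsub>opposite_ring R\<^esub> y = x \<oplus>\<^bsub>R\<^esub> y"
  by (simp_all add: opposite_ring_def)

lemma (in ring) ring_opposite: "ring (opposite_ring R)"
proof (rule ringI)
  show "abelian_group (opposite_ring R)"
    by (rule abelian_groupI) (auto simp: a_ac intro: l_neg)
  show "Group.monoid (opposite_ring R)"
    by (rule monoidI) (auto simp: m_assoc)
qed (auto simp: l_distr r_distr)

lemma (in ring) minus_opposite:
  assumes "x \<in> carrier R" "y \<in> carrier R"
  shows "x \<ominus>\<^bsub>opposite_ring R\<^esub> y = x \<ominus> y"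
proof -
  interpret O: ring "opposite_ring R"
    by (rule ring_opposite)
  have "\<ominus>\<^bsub>opposite_ring R\<^esub> y = \<ominus> y"
    by (rule O.minus_equality) (use assms in \<open>auto simp: l_neg\<close>)
  then show ?thesis
    by (simp add: a_minus_def)
qed

lemma (in ring) list_prod_opposite:
  "set xs \<subseteq> carrier R \<Longrightarrow> list_prod (opposite_ring R) xs = list_prod R (rev xs)"
  by (induction xs) (auto simp: list_prod_append)

context hecke_hopf_data
begin

text \<open>s D s D = (1 - s - D) D = D - s D - D. Hence - s D, the intended value of the antipode,
  is idempotent.\<close>

lemma s_D_s_D: "i \<in> I \<Longrightarrow> s i \<otimes> D i \<otimes> (s i \<otimes> D i) = \<ominus> (s i \<otimes> D i)"
proof -
  assume i: "i \<in> I"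
  have "s i \<otimes> D i \<otimes> (s i \<otimes> D i) = s i \<otimes> D i \<otimes> s i \<otimes> D i"
    using i by (simp add: m_assoc)
  also have "\<dots> = \<ominus> (s i \<otimes> D i)"
    using i by (simp add: s_D_s minus_eq l_distr l_minus D_D a_assoc[symmetric])
      (simp add: a_assoc a_comm[of "\<ominus> (s i \<otimes> D i)"] r_neg2)
  finally show ?thesis .
qed

lemma hecke_hopf_data_opposite:
  "hecke_hopf_data (opposite_ring R) I m s (\<lambda>i. \<ominus> (s i \<otimes> D i))"
proof (intro hecke_hopf_data.intro ring_opposite hecke_hopf_data_axioms.intro)
  fix i assume i: "i \<in> I"
  show "\<ominus> (s i \<otimes> D i) \<otimes>\<^bsub>opposite_ring R\<^esub> \<ominus> (s i \<otimes> D i) = \<ominus> (s i \<otimes> D i)"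
    using i by (simp add: l_minus r_minus s_D_s_D)
  \<comment> \<open>With the factors swapped, the left side of the mixed relation is - s D s - D = -
    (1 - s - D) - D = s - 1.\<close>
  have "\<ominus> (s i \<otimes> D i) \<otimes> s i \<oplus> s i \<otimes> \<ominus> (s i \<otimes> D i) = \<ominus> (s i \<otimes> D i \<otimes> s i) \<oplus> \<ominus> (s i \<otimes> s i \<otimes> D i)"
    using i by (simp add: l_minus r_minus m_assoc)
  also have "\<dots> = s i \<ominus> \<one>"
    using i by (simp add: s_D_s s_s minus_eq minus_add a_assoc r_neg1 r_neg2 a_comm)
  finally show "s i \<otimes>\<^bsub>opposite_ring R\<^esub> \<ominus> (s i \<otimes> D i) \<oplus>\<^bsub>opposite_ring R\<^esub>
      \<ominus> (s i \<otimes> D i) \<otimes>\<^bsub>opposite_ring R\<^esub> s i = s i \<ominus>\<^bsub>opposite_ring R\<^esub> \<one>\<^bsub>opposite_ring R\<^esub>"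
    using i by (simp add: minus_opposite)
next
  fix i j assume ij: "i \<in> I" "j \<in> I"
  \<comment> \<open>In the opposite ring the word is read backwards, which gives the inverse of a
    word whose product is 1.\<close>
  show "list_prod (opposite_ring R) (alt (2 * m i j) (s i) (s j)) = \<one>\<^bsub>opposite_ring R\<^esub>"
    using list_prod_alt_inverse(1)[OF ij, of "2 * m i j"] coxeter[OF ij] ij set_alt_closed
    by (simp add: list_prod_opposite)
  assume m: "i \<noteq> j" "m i j \<noteq> 0"
  let ?i' = "if even (m i j) then i else j"
  define w where "w = list_prod R (alt (m i j - 1) (s j) (s i))"
  \<comment> \<open>\<open>v\<close> is at once the inverse of \<open>w\<close> and the product of
    the same word in the opposite ring. The relation to be shown therefore says that
    \<open>v\<close> moves past \<open>s D\<close> from left to right, changing the index;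
    \<open>conj\<close> gives this for \<open>s\<close> and \<open>D\<close> separately.\<close>
  define v where "v = list_prod R (rev (alt (m i j - 1) (s j) (s i)))"
  have c: "w \<in> carrier R" "v \<in> carrier R" "?i' \<in> I"
    using ij set_alt_closed by (auto simp: w_def v_def)
  have vw: "v \<otimes> w = \<one>" and wv: "w \<otimes> v = \<one>"
    using list_prod_alt_inverse[OF ij(2,1), of "m i j - 1"] by (simp_all add: w_def v_def)
  have conj: "v \<otimes> x = y \<otimes> v" if "x \<otimes> w = w \<otimes> y" "x \<in> carrier R" "y \<in> carrier R" for x y
  proof -
    have "v \<otimes> x = v \<otimes> x \<otimes> (w \<otimes> v)"
      using c that wv by simp
    also have "\<dots> = v \<otimes> (x \<otimes> w) \<otimes> v"
      using c that(2,3) by (simp add: m_assoc)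
    also have "\<dots> = (v \<otimes> w) \<otimes> (y \<otimes> v)"
      using c that(2,3) unfolding that(1) by (simp add: m_assoc)
    also have "\<dots> = y \<otimes> v"
      using c that vw by simp
    finally show ?thesis .
  qed
  have s: "v \<otimes> s i = s ?i' \<otimes> v"
    using coxeter_braid[OF ij m(2)] c ij by (intro conj) (auto simp: w_def)
  have D: "v \<otimes> D i = D ?i' \<otimes> v"
    using braid[OF ij m] c ij by (intro conj) (auto simp: w_def)
  have "v \<otimes> (s i \<otimes> D i) = v \<otimes> s i \<otimes> D i"
    using c ij by (simp add: m_assoc)
  also have "\<dots> = s ?i' \<otimes> (v \<otimes> D i)"
    using c ij by (simp add: s m_assoc del: if_split)
  also have "\<dots> = s ?i' \<otimes> D ?i' \<otimes> v"
    using c s_closed[OF c(3)] D_closed[OF c(3)] by (simp only: D m_assoc)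
  finally have "v \<otimes> \<ominus> (s i \<otimes> D i) = \<ominus> (s ?i' \<otimes> D ?i') \<otimes> v"
    using c ij s_closed[OF c(3)] D_closed[OF c(3)] by (simp only: r_minus l_minus m_closed s_closed D_closed)
  then show "\<ominus> (s i \<otimes> D i) \<otimes>\<^bsub>opposite_ring R\<^esub> list_prod (opposite_ring R) (alt (m i j - 1) (s j) (s i)) =
      list_prod (opposite_ring R) (alt (m i j - 1) (s j) (s i)) \<otimes>\<^bsub>opposite_ring R\<^esub>
        \<ominus> (s ?i' \<otimes> D ?i')"
    using ij set_alt_closed[of j i] by (simp only: list_prod_opposite opposite_ring_simps v_def)
qed (simp_all add: s_s)

text \<open>Pure tensors multiply factorwise, so a word w in the elements s \<otimes> s has product
  w \<otimes> w. The Coxeter relation in the tensor square is then immediate, and the braid relation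
  can be checked in each tensor factor.\<close>

lemma list_prod_alt_tens:
  assumes "a \<in> carrier R" "b \<in> carrier R"
  shows "list_prod (tensor_ring R R) (alt n (tens R R a a) (tens R R b b)) =
    tens R R (list_prod R (alt n a b)) (list_prod R (alt n a b))"
proof -
  interpret RR: two_rings R R ..
  show ?thesis
    using assms
  proof (induction n arbitrary: a b)
    case (Suc n)
    then have "set (alt n b a) \<subseteq> carrier R"
      using set_alt[of n b a] by auto
    with Suc show ?case
      by (simp add: RR.tens_mult)
  qed (simp add: RR.tens_one)
qed

lemma hecke_hopf_data_tensor:
  "hecke_hopf_data (tensor_ring R R) I m (\<lambda>i. tens R R (s i) (s i))
    (\<lambda>i. tens R R (D i) \<one> \<oplus>\<^bsub>tensor_ring R R\<^esub> tens R R (s i) (D i))"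
proof -
  interpret RR: two_rings R R ..
  show ?thesis
  proof (intro hecke_hopf_data.intro RR.ring_tensor_ring hecke_hopf_data_axioms.intro)
    fix i assume i: "i \<in> I"
    let ?T = "tensor_ring R R"
    \<comment> \<open>The square is D \<otimes> 1 + (s D + D s + 1) \<otimes> D, where the last 1 is
      s s, and the mixed relation turns the bracket into s.\<close>
    have "(tens R R (D i) \<one> \<oplus>\<^bsub>?T\<^esub> tens R R (s i) (D i)) \<otimes>\<^bsub>?T\<^esub> (tens R R (D i) \<one> \<oplus>\<^bsub>?T\<^esub> tens R R (s i) (D i)) =
        tens R R (D i) \<one> \<oplus>\<^bsub>?T\<^esub> (tens R R (s i \<otimes> D i) (D i) \<oplus>\<^bsub>?T\<^esub> tens R R (D i \<otimes> s i) (D i) \<oplus>\<^bsub>?T\<^esub> tens R R \<one> (D i))"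
      using i by (simp add: RR.T.l_distr RR.T.r_distr RR.tens_mult D_D s_s RR.T.a_assoc RR.T.a_comm RR.T.a_lcomm)
    also have "tens R R (s i \<otimes> D i) (D i) \<oplus>\<^bsub>?T\<^esub> tens R R (D i \<otimes> s i) (D i) \<oplus>\<^bsub>?T\<^esub> tens R R \<one> (D i) =
        tens R R (s i \<ominus> \<one> \<oplus> \<one>) (D i)"
      using i by (simp add: RR.tens_add_left s_D flip: RR.tens_add_left)
    also have "s i \<ominus> \<one> \<oplus> \<one> = s i"
      using i by (simp add: minus_eq a_assoc l_neg)
    finally show "(tens R R (D i) \<one> \<oplus>\<^bsub>?T\<^esub> tens R R (s i) (D i)) \<otimes>\<^bsub>?T\<^esub> (tens R R (D i) \<one> \<oplus>\<^bsub>?T\<^esub> tens R R (s i) (D i)) =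
        tens R R (D i) \<one> \<oplus>\<^bsub>?T\<^esub> tens R R (s i) (D i)" .
    \<comment> \<open>The mixed relation in each tensor factor gives (s - 1) \<otimes> s + 1
      \<otimes> (s - 1), in which the two terms 1 \<otimes> s cancel.\<close>
    have "tens R R (s i) (s i) \<otimes>\<^bsub>?T\<^esub> (tens R R (D i) \<one> \<oplus>\<^bsub>?T\<^esub> tens R R (s i) (D i)) \<oplus>\<^bsub>?T\<^esub>
        (tens R R (D i) \<one> \<oplus>\<^bsub>?T\<^esub> tens R R (s i) (D i)) \<otimes>\<^bsub>?T\<^esub> tens R R (s i) (s i) =
        (tens R R (s i \<otimes> D i) (s i) \<oplus>\<^bsub>?T\<^esub> tens R R (D i \<otimes> s i) (s i)) \<oplus>\<^bsub>?T\<^esub>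
        (tens R R \<one> (s i \<otimes> D i) \<oplus>\<^bsub>?T\<^esub> tens R R \<one> (D i \<otimes> s i))"
      using i by (simp add: RR.T.l_distr RR.T.r_distr RR.tens_mult s_s RR.T.a_assoc RR.T.a_comm RR.T.a_lcomm)
    also have "\<dots> = tens R R (s i \<ominus> \<one>) (s i) \<oplus>\<^bsub>?T\<^esub> tens R R \<one> (s i \<ominus> \<one>)"
      using i by (simp add: s_D flip: RR.tens_add_left RR.tens_add_right)
    also have "\<dots> = tens R R (s i) (s i) \<ominus>\<^bsub>?T\<^esub> \<one>\<^bsub>?T\<^esub>"
      using i by (simp add: RR.tens_minus_left RR.tens_minus_right RR.tens_one RR.T.minus_eq RR.T.a_assoc RR.T.r_neg1)
    finally show "tens R R (s i) (s i) \<otimes>\<^bsub>?T\<^esub> (tens R R (D i) \<one> \<oplus>\<^bsub>?T\<^esub> tens R R (s i) (D i)) \<oplus>\<^bsub>?T\<^esub>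
        (tens R R (D i) \<one> \<oplus>\<^bsub>?T\<^esub> tens R R (s i) (D i)) \<otimes>\<^bsub>?T\<^esub> tens R R (s i) (s i) =
        tens R R (s i) (s i) \<ominus>\<^bsub>?T\<^esub> \<one>\<^bsub>?T\<^esub>" .
  next
    fix i j assume ij: "i \<in> I" "j \<in> I" and m: "i \<noteq> j" "m i j \<noteq> 0"
    let ?T = "tensor_ring R R" and ?w = "list_prod R (alt (m i j - 1) (s j) (s i))"
    have w: "?w \<in> carrier R"
      using ij set_alt_closed by simp
    \<comment> \<open>The left side expands to D w \<otimes> w + s w \<otimes> D w: in the second
      summand \<open>coxeter_braid\<close> acts on the left factor and \<open>braid\<close> on the
      right one.\<close>
    show "(tens R R (D i) \<one> \<oplus>\<^bsub>?T\<^esub> tens R R (s i) (D i)) \<otimes>\<^bsub>?T\<^esub>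
        list_prod ?T (alt (m i j - 1) (tens R R (s j) (s j)) (tens R R (s i) (s i))) =
        list_prod ?T (alt (m i j - 1) (tens R R (s j) (s j)) (tens R R (s i) (s i))) \<otimes>\<^bsub>?T\<^esub>
        (tens R R (D (if even (m i j) then i else j)) \<one> \<oplus>\<^bsub>?T\<^esub>
          tens R R (s (if even (m i j) then i else j)) (D (if even (m i j) then i else j)))"
      using w ij braid[OF ij m] coxeter_braid[OF ij m(2)]
      by (simp add: list_prod_alt_tens RR.T.l_distr RR.T.r_distr RR.tens_mult split: if_splits)
  qed (simp_all add: RR.tens_mult s_s RR.tens_one list_prod_alt_tens coxeter)
qed

end

lemma (in ring) scalar_simps:
  fixes n k :: int
  shows scalar_closed: "[n] \<cdot> \<one> \<in> carrier R"
    and scalar_mult_left: "x \<in> carrier R \<Longrightarrow> [n] \<cdot> \<one> \<otimes> x = [n] \<cdot> x"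
    and scalar_mult_right: "x \<in> carrier R \<Longrightarrow> x \<otimes> [n] \<cdot> \<one> = [n] \<cdot> x"
    and scalar_diff: "[(n - k)] \<cdot> \<one> = [n] \<cdot> \<one> \<ominus> [k] \<cdot> \<one>"
    and scalar_add: "x \<in> carrier R \<Longrightarrow> [(n + k)] \<cdot> x = [n] \<cdot> x \<oplus> [k] \<cdot> x"
    and scalar_scalar: "x \<in> carrier R \<Longrightarrow> [n] \<cdot> ([k] \<cdot> x) = [(n * k)] \<cdot> x"
    and scalar_one: "x \<in> carrier R \<Longrightarrow> [(1::int)] \<cdot> x = x"
    and scalar_zero: "[(0::int)] \<cdot> x = \<zero>"
    and scalar_distrib: "x \<in> carrier R \<Longrightarrow> y \<in> carrier R \<Longrightarrow> [n] \<cdot> (x \<oplus> y) = [n] \<cdot> x \<oplus> [n] \<cdot> y"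
proof -
  show "[n] \<cdot> \<one> \<in> carrier R"
    by simp
  show "x \<in> carrier R \<Longrightarrow> [n] \<cdot> \<one> \<otimes> x = [n] \<cdot> x"
    by (simp add: add_pow_ldistr_int)
  show "x \<in> carrier R \<Longrightarrow> x \<otimes> [n] \<cdot> \<one> = [n] \<cdot> x"
    by (simp add: add_pow_rdistr_int)
  show "[(n - k)] \<cdot> \<one> = [n] \<cdot> \<one> \<ominus> [k] \<cdot> \<one>"
    by (simp add: add.int_pow_diff minus_eq)
  show "x \<in> carrier R \<Longrightarrow> [(n + k)] \<cdot> x = [n] \<cdot> x \<oplus> [k] \<cdot> x"
    by (simp add: add.int_pow_mult)
  show "x \<in> carrier R \<Longrightarrow> [n] \<cdot> ([k] \<cdot> x) = [(n * k)] \<cdot> x"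
    by (simp add: add.int_pow_pow mult.commute)
  show "x \<in> carrier R \<Longrightarrow> [(1::int)] \<cdot> x = x"
    by (simp add: add.int_pow_1)
  show "[(0::int)] \<cdot> x = \<zero>"
    by (simp add: add_pow_def)
  show "x \<in> carrier R \<Longrightarrow> y \<in> carrier R \<Longrightarrow> [n] \<cdot> (x \<oplus> y) = [n] \<cdot> x \<oplus> [n] \<cdot> y"
    by (simp add: add.int_pow_distrib)
qed

text \<open>Collects what the universal property supplies: three homomorphisms, with S landing in
  the opposite ring, and their values on generators. All Hopf laws are derived from these data, so
  they hold for the restricted maps of the final theorem as well.\<close>

locale hecke_hopf_structure =
  fixes I :: "'i set" and m :: "'i \<Rightarrow> 'i \<Rightarrow> nat" and H (structure) and s D \<Delta> \<epsilon> S
  defines "H \<equiv> hecke_hopf I m" and "s \<equiv> gen_s I m" and "D \<equiv> gen_D I m"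
  assumes Delta_hom: "\<Delta> \<in> ring_hom H (tensor_ring H H)"
    and eps_hom: "\<epsilon> \<in> ring_hom H \<Z>"
    and S_hom: "S \<in> ring_hom H (opposite_ring H)"
    and Delta_s: "i \<in> I \<Longrightarrow> \<Delta> (s i) = tens H H (s i) (s i)"
    and Delta_D: "i \<in> I \<Longrightarrow> \<Delta> (D i) = tens H H (D i) \<one> \<oplus>\<^bsub>tensor_ring H H\<^esub> tens H H (s i) (D i)"
    and eps_s: "i \<in> I \<Longrightarrow> \<epsilon> (s i) = 1"
    and eps_D: "i \<in> I \<Longrightarrow> \<epsilon> (D i) = 0"
    and S_s: "i \<in> I \<Longrightarrow> S (s i) = s i"
    and S_D: "i \<in> I \<Longrightarrow> S (D i) = \<ominus> (s i \<otimes> D i)"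
begin

sublocale hecke_hopf_data H I m s D
  unfolding H_def s_def D_def by (rule hecke_hopf_data_hecke_hopf)

sublocale HH: two_rings H H ..
sublocale HHH: three_rings H H H ..
sublocale TH: two_rings "tensor_ring H H" H
  by (simp add: two_rings_def ring_axioms HH.ring_tensor_ring)
sublocale \<Delta>: ring_hom_ring H "tensor_ring H H" \<Delta>
  by (rule ring_hom_ringI2[OF ring_axioms HH.ring_tensor_ring Delta_hom])

lemma eps_simps:
  "x \<in> carrier H \<Longrightarrow> y \<in> carrier H \<Longrightarrow> \<epsilon> (x \<oplus> y) = \<epsilon> x + \<epsilon> y"
  "x \<in> carrier H \<Longrightarrow> y \<in> carrier H \<Longrightarrow> \<epsilon> (x \<otimes> y) = \<epsilon> x * \<epsilon> y"
  "x \<in> carrier H \<Longrightarrow> y \<in> carrier H \<Longrightarrow> \<epsilon> (x \<ominus> y) = \<epsilon> x - \<epsilon> y"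
  "\<epsilon> \<one> = 1"
proof -
  interpret e: ring_hom_ring H \<Z> \<epsilon>
    by (rule ring_hom_ringI2[OF ring_axioms int.ring_axioms eps_hom])
  show "x \<in> carrier H \<Longrightarrow> y \<in> carrier H \<Longrightarrow> \<epsilon> (x \<oplus> y) = \<epsilon> x + \<epsilon> y"
    "x \<in> carrier H \<Longrightarrow> y \<in> carrier H \<Longrightarrow> \<epsilon> (x \<otimes> y) = \<epsilon> x * \<epsilon> y"
    "x \<in> carrier H \<Longrightarrow> y \<in> carrier H \<Longrightarrow> \<epsilon> (x \<ominus> y) = \<epsilon> x - \<epsilon> y"
    "\<epsilon> \<one> = 1"
    by (simp_all add: minus_eq int_a_inv_eq)
qed

lemma S_simps:
  "x \<in> carrier H \<Longrightarrow> S x \<in> carrier H"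
  "x \<in> carrier H \<Longrightarrow> y \<in> carrier H \<Longrightarrow> S (x \<oplus> y) = S x \<oplus> S y"
  "x \<in> carrier H \<Longrightarrow> y \<in> carrier H \<Longrightarrow> S (x \<otimes> y) = S y \<otimes> S x"
  "S \<one> = \<one>"
  using ring_hom_closed[OF S_hom] ring_hom_add[OF S_hom] ring_hom_mult[OF S_hom] ring_hom_one[OF S_hom] by simp_all

lemma S_minus:
  assumes "x \<in> carrier H"
  shows "S (\<ominus> x) = \<ominus> S x"
proof -
  interpret h: abelian_group_hom H H S
    by (rule abelian_group_homI'[OF ring_axioms ring_axioms add_homI]) (simp_all add: S_simps)
  show ?thesis
    using assms by simp
qed

lemma hom_eqI:
  assumes "ring R" "f \<in> ring_hom H R" "g \<in> ring_hom H R"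
    and "\<And>i. i \<in> I \<Longrightarrow> f (s i) = g (s i)" "\<And>i. i \<in> I \<Longrightarrow> f (D i) = g (D i)"
    and "x \<in> carrier H"
  shows "f x = g x"
  using assms hecke_hopf_hom_eqI[of R f I m g x] by (simp add: H_def s_def D_def)

text \<open>\<open>S \<circ> S\<close> fixes \<open>s\<^sub>i\<close> and sends \<open>D\<^sub>i\<close> to \<open>1 - s\<^sub>i - D\<^sub>i\<close>, so \<open>S\<close> has order dividing 4.\<close>

lemma S_anti_automorphism: "anti_automorphism H S"
proof -
  \<comment> \<open>Two reversals cancel, so this composite is an ordinary homomorphism, and its
    square can be compared with the identity on generators.\<close>
  have SS: "S \<circ> S \<in> ring_hom H H"
    by (rule ring_hom_memI) (simp_all add: S_simps)
  \<comment> \<open>As S reverses products, S(- s D) = - S(D) s = s D s.\<close>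
  have SS_D: "S (S (D i)) = \<one> \<ominus> s i \<ominus> D i" if "i \<in> I" for i
    using that by (simp add: S_D S_s S_minus S_simps l_minus s_D_s)
  have "((S \<circ> S) \<circ> (S \<circ> S)) x = id x" if "x \<in> carrier H" for x
  proof (rule hom_eqI[OF ring_axioms ring_hom_trans[OF SS SS] _ _ _ that])
    fix i assume i: "i \<in> I"
    show "((S \<circ> S) \<circ> (S \<circ> S)) (D i) = id (D i)"
      using i by (simp add: SS_D minus_eq S_simps S_minus S_s minus_add a_assoc r_neg1 r_neg2 a_lcomm[of _ "\<ominus> \<one>"])
  qed (auto simp: S_s ring_hom_def)
  then have inv: "S (S (S (S x))) = x" if "x \<in> carrier H" for x
    using that by simp
  have "bij_betw S (carrier H) (carrier H)"
    by (rule bij_betw_byWitness[where f' = "\<lambda>x. S (S (S x))"]) (auto simp: inv S_simps)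
  then show ?thesis
    unfolding anti_automorphism_def ring_iso_def using S_hom by simp
qed

section \<open>Coassociativity, counit laws and antipode laws\<close>

lemma coassociative:
  assumes x: "x \<in> carrier H"
  shows "tensor_assoc H H H (tensor_map (tensor_ring H H) H \<Delta> (\<lambda>b. b) (\<Delta> x)) =
    tensor_map H (tensor_ring H H) (\<lambda>a. a) \<Delta> (\<Delta> x)"
proof -
  let ?T = "tensor_ring H H" and ?T3 = "tensor_ring H (tensor_ring H H)"
  have id: "(\<lambda>b. b) \<in> ring_hom H H"
    by (rule ring_hom_memI) simp_all
  note left_hom = tensor_map_ring_hom[OF ring_axioms ring_axioms HH.ring_tensor_ring ring_axioms Delta_hom id]
  note left_tens = tensor_map_tens[OF ring_axioms ring_axioms HH.ring_tensor_ring ring_axioms Delta_hom id]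
  note right_hom = tensor_map_ring_hom[OF ring_axioms ring_axioms ring_axioms HH.ring_tensor_ring id Delta_hom]
  note right_tens = tensor_map_tens[OF ring_axioms ring_axioms ring_axioms HH.ring_tensor_ring id Delta_hom]
  have "(tensor_assoc H H H \<circ> (tensor_map ?T H \<Delta> (\<lambda>b. b) \<circ> \<Delta>)) x =
      (tensor_map H ?T (\<lambda>a. a) \<Delta> \<circ> \<Delta>) x"
  proof (rule hom_eqI[OF HHH.T.ring_tensor_ring
        ring_hom_trans[OF ring_hom_trans[OF Delta_hom left_hom] HHH.tensor_assoc_ring_hom]
        ring_hom_trans[OF Delta_hom right_hom] _ _ x])
    fix i assume i: "i \<in> I"
    show "(tensor_assoc H H H \<circ> (tensor_map ?T H \<Delta> (\<lambda>b. b) \<circ> \<Delta>)) (s i) =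
        (tensor_map H ?T (\<lambda>a. a) \<Delta> \<circ> \<Delta>) (s i)"
      using i by (simp add: Delta_s left_tens right_tens HHH.tensor_assoc_tens)
    \<comment> \<open>On D both sides are D \<otimes> 1 \<otimes> 1 + s \<otimes> D \<otimes> 1 + s
      \<otimes> s \<otimes> D, up to bracketing.\<close>
    have "tensor_map ?T H \<Delta> (\<lambda>b. b) (\<Delta> (D i)) =
        tens ?T H (tens H H (D i) \<one>) \<one> \<oplus>\<^bsub>tensor_ring ?T H\<^esub> tens ?T H (tens H H (s i) (D i)) \<one>
          \<oplus>\<^bsub>tensor_ring ?T H\<^esub> tens ?T H (tens H H (s i) (s i)) (D i)"
      using i by (simp add: Delta_D Delta_s ring_hom_add[OF left_hom] left_tens TH.tens_add_left)
    then have "tensor_assoc H H H (tensor_map ?T H \<Delta> (\<lambda>b. b) (\<Delta> (D i))) =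
        tens H ?T (D i) (tens H H \<one> \<one>) \<oplus>\<^bsub>?T3\<^esub> tens H ?T (s i) (tens H H (D i) \<one>)
          \<oplus>\<^bsub>?T3\<^esub> tens H ?T (s i) (tens H H (s i) (D i))"
      using i by (simp add: ring_hom_add[OF HHH.tensor_assoc_ring_hom] HHH.tensor_assoc_tens)
    also have "\<dots> = tensor_map H ?T (\<lambda>a. a) \<Delta> (\<Delta> (D i))"
      using i by (simp add: Delta_D ring_hom_add[OF right_hom] right_tens HHH.T.tens_add_right HH.tens_one HHH.T.T.a_assoc)
    finally show "(tensor_assoc H H H \<circ> (tensor_map ?T H \<Delta> (\<lambda>b. b) \<circ> \<Delta>)) (D i) =
        (tensor_map H ?T (\<lambda>a. a) \<Delta> \<circ> \<Delta>) (D i)"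
      by simp
  qed
  then show ?thesis
    by simp
qed

lemma counital:
  assumes x: "x \<in> carrier H"
  shows "tensor_lift H (\<lambda>a b. [\<epsilon> a] \<cdot> b) (\<Delta> x) = x"
    and "tensor_lift H (\<lambda>a b. [\<epsilon> b] \<cdot> a) (\<Delta> x) = x"
proof -
  interpret l: biadditive_map H H H "\<lambda>a b. [\<epsilon> a] \<cdot> b"
    by (intro biadditive_mapI ring_axioms) (simp add: biadditive_def eps_simps scalar_add scalar_distrib)
  interpret r: biadditive_map H H H "\<lambda>a b. [\<epsilon> b] \<cdot> a"
    by (intro biadditive_mapI ring_axioms) (simp add: biadditive_def eps_simps scalar_add scalar_distrib)
  \<comment> \<open>Integer scalars are central and the counit is multiplicative, so these lifts,
    unlike those of the antipode laws, are ring homomorphisms.\<close>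
  have l: "tensor_lift H (\<lambda>a b. [\<epsilon> a] \<cdot> b) \<in> ring_hom (tensor_ring H H) H"
    by (rule l.tensor_lift_ring_hom)
      (simp_all add: eps_simps scalar_one add_pow_ldistr_int add_pow_rdistr_int scalar_scalar mult.commute)
  have r: "tensor_lift H (\<lambda>a b. [\<epsilon> b] \<cdot> a) \<in> ring_hom (tensor_ring H H) H"
    by (rule r.tensor_lift_ring_hom)
      (simp_all add: eps_simps scalar_one add_pow_ldistr_int add_pow_rdistr_int scalar_scalar mult.commute)
  have id: "id \<in> ring_hom H H"
    by (rule ring_hom_memI) simp_all
  have "(tensor_lift H (\<lambda>a b. [\<epsilon> a] \<cdot> b) \<circ> \<Delta>) x = id x"
    by (rule hom_eqI[OF ring_axioms ring_hom_trans[OF Delta_hom l] id _ _ x])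
      (simp_all add: Delta_s Delta_D eps_s eps_D scalar_one scalar_zero)
  then show "tensor_lift H (\<lambda>a b. [\<epsilon> a] \<cdot> b) (\<Delta> x) = x"
    by simp
  have "(tensor_lift H (\<lambda>a b. [\<epsilon> b] \<cdot> a) \<circ> \<Delta>) x = id x"
    by (rule hom_eqI[OF ring_axioms ring_hom_trans[OF Delta_hom r] id _ _ x])
      (simp_all add: Delta_s Delta_D eps_s eps_D eps_simps scalar_one scalar_zero)
  then show "tensor_lift H (\<lambda>a b. [\<epsilon> b] \<cdot> a) (\<Delta> x) = x"
    by simp
qed

sublocale Sl: biadditive_map H H H "\<lambda>a b. S a \<otimes> b"
  by (intro biadditive_mapI ring_axioms) (simp add: biadditive_def S_simps l_distr r_distr)

sublocale Sr: biadditive_map H H H "\<lambda>a b. a \<otimes> S b"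
  by (intro biadditive_mapI ring_axioms) (simp add: biadditive_def S_simps l_distr r_distr)

text \<open>
  The map \<open>a \<otimes> b \<mapsto> S a b\<close> is not multiplicative, but it sends \<open>t (c \<otimes> d)\<close> to
  \<open>S c\<close> times the image of \<open>t\<close> times \<open>d\<close>.
\<close>

lemma Sl_mult:
  fixes n :: int
  assumes t: "t \<in> carrier (tensor_ring H H)" and u: "u \<in> carrier (tensor_ring H H)"
    and n: "tensor_lift H (\<lambda>a b. S a \<otimes> b) t = [n] \<cdot> \<one>"
  shows "tensor_lift H (\<lambda>a b. S a \<otimes> b) (t \<otimes>\<^bsub>tensor_ring H H\<^esub> u) =
    [n] \<cdot> \<one> \<otimes> tensor_lift H (\<lambda>a b. S a \<otimes> b) u"
  using u
proof (induction u rule: HH.tensor_induct)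
  case (diff u v)
  then show ?case
    using t by (simp add: HH.T.minus_eq HH.T.r_distr HH.T.r_minus r_distr r_minus scalar_closed)
next
  case (tens c d)
  have "tensor_lift H (\<lambda>a b. S a \<otimes> b) (t \<otimes>\<^bsub>tensor_ring H H\<^esub> tens H H c d) =
      S c \<otimes> tensor_lift H (\<lambda>a b. S a \<otimes> b) t \<otimes> d"
    using t
  proof (induction t rule: HH.tensor_induct)
    case (diff t v)
    then show ?case
      using tens by (simp add: HH.T.minus_eq HH.T.l_distr HH.T.l_minus r_distr l_distr r_minus l_minus S_simps)
  next
    case (tens a b)
    then show ?case
      using \<open>c \<in> carrier H\<close> \<open>d \<in> carrier H\<close> by (simp add: HH.tens_mult S_simps m_assoc)
  qed (use tens in \<open>simp add: S_simps\<close>)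
  \<comment> \<open>The image of \<open>t\<close> stands between \<open>S c\<close> and
    \<open>d\<close>; being an integer multiple of 1, it can be moved to the front.\<close>
  then show ?case
    using tens by (simp add: n S_simps scalar_mult_left scalar_mult_right add_pow_ldistr_int)
qed (use t in \<open>simp add: scalar_closed\<close>)

text \<open>The mirror image: (c \<otimes> d) u goes to c, times the image of \<open>u\<close>,
  times \<open>S d\<close>. The right factor \<open>u\<close> now ends up in the middle, so it is
  the one whose image must be a scalar.\<close>

lemma Sr_mult:
  fixes n :: int
  assumes t: "t \<in> carrier (tensor_ring H H)" and u: "u \<in> carrier (tensor_ring H H)"
    and n: "tensor_lift H (\<lambda>a b. a \<otimes> S b) u = [n] \<cdot> \<one>"
  shows "tensor_lift H (\<lambda>a b. a \<otimes> S b) (t \<otimes>\<^bsub>tensor_ring H H\<^esub> u) =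
    tensor_lift H (\<lambda>a b. a \<otimes> S b) t \<otimes> [n] \<cdot> \<one>"
  using t
proof (induction t rule: HH.tensor_induct)
  case (diff t v)
  then show ?case
    using u by (simp add: HH.T.minus_eq HH.T.l_distr HH.T.l_minus l_distr l_minus scalar_closed)
next
  case (tens c d)
  have "tensor_lift H (\<lambda>a b. a \<otimes> S b) (tens H H c d \<otimes>\<^bsub>tensor_ring H H\<^esub> u) =
      c \<otimes> tensor_lift H (\<lambda>a b. a \<otimes> S b) u \<otimes> S d"
    using u
  proof (induction u rule: HH.tensor_induct)
    case (diff t v)
    then show ?case
      using tens by (simp add: HH.T.minus_eq HH.T.r_distr HH.T.r_minus r_distr l_distr r_minus l_minus S_simps)
  next
    case (tens a b)
    then show ?case
      using \<open>c \<in> carrier H\<close> \<open>d \<in> carrier H\<close> by (simp add: HH.tens_mult S_simps m_assoc)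
  qed (use tens in \<open>simp add: S_simps\<close>)
  then show ?case
    using tens by (simp add: n S_simps scalar_mult_left scalar_mult_right add_pow_ldistr_int)
qed (use u in \<open>simp add: scalar_closed\<close>)

lemma antipode:
  assumes "x \<in> carrier H"
  shows "tensor_lift H (\<lambda>a b. S a \<otimes> b) (\<Delta> x) = [\<epsilon> x] \<cdot> \<one>"
    and "tensor_lift H (\<lambda>a b. a \<otimes> S b) (\<Delta> x) = [\<epsilon> x] \<cdot> \<one>"
proof -
  from assms have "tensor_lift H (\<lambda>a b. S a \<otimes> b) (\<Delta> x) = [\<epsilon> x] \<cdot> \<one> \<and>
    tensor_lift H (\<lambda>a b. a \<otimes> S b) (\<Delta> x) = [\<epsilon> x] \<cdot> \<one>"
  proof (induction x rule: hecke_hopf_induct[where I = I and m = m, folded H_def s_def D_def, consumes 1, case_names one diff mult s D])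
    case one
    show ?case
      by (simp add: S_simps eps_simps scalar_one flip: HH.tens_one)
  next
    case (diff x y)
    then show ?case
      by (simp add: minus_eq[of x y] eps_simps(3)[unfolded minus_eq] scalar_diff)
        (simp add: minus_eq)
  next
    case (mult x y)
    \<comment> \<open>Comultiplication is multiplicative. The left law for the product uses the
      scalar value at \<open>x\<close> in \<open>Sl_mult\<close>, the right law the scalar value at
      \<open>y\<close> in \<open>Sr_mult\<close>.\<close>
    then show ?case
      by (simp add: Sl_mult Sr_mult eps_simps scalar_closed scalar_mult_left scalar_mult_right scalar_scalar mult.commute)
  next
    case (s i)
    then show ?case
      by (simp add: Delta_s S_s s_s eps_s scalar_one)
  next
    case (D i)
    \<comment> \<open>The two values are - s D + s D and D - s s D, both zero.\<close>
    then show ?case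
      by (simp add: Delta_D S_s S_D S_simps eps_D scalar_zero l_neg r_neg r_minus s_s flip: m_assoc)
  qed
  then show "tensor_lift H (\<lambda>a b. S a \<otimes> b) (\<Delta> x) = [\<epsilon> x] \<cdot> \<one>"
    "tensor_lift H (\<lambda>a b. a \<otimes> S b) (\<Delta> x) = [\<epsilon> x] \<cdot> \<one>"
    by simp_all
qed

lemma hopf_algebra: "hopf_algebra H \<Delta> \<epsilon> S"
  by (intro hopf_algebra.intro bialgebra.intro ring_axioms bialgebra_axioms.intro hopf_algebra_axioms.intro
      Delta_hom eps_hom coassociative counital antipode add_homI S_simps)

end

theorem theorem1p16:
  fixes I :: "'i set" and m :: "'i \<Rightarrow> 'i \<Rightarrow> nat"
  assumes "coxeter_matrix I m"
  shows "let H = hecke_hopf I m; s = gen_s I m; D = gen_D I m in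
    \<exists>!(\<Delta>, \<epsilon>, S).
      \<Delta> \<in> extensional (carrier H) \<and> \<epsilon> \<in> extensional (carrier H) \<and> S \<in> extensional (carrier H) \<and>
      hopf_algebra H \<Delta> \<epsilon> S \<and> anti_automorphism H S \<and>
      (\<forall>i\<in>I.
        \<Delta> (s i) = tens H H (s i) (s i) \<and>
        \<Delta> (D i) = tens H H (D i) \<one>\<^bsub>H\<^esub> \<oplus>\<^bsub>tensor_ring H H\<^esub> tens H H (s i) (D i) \<and>
        \<epsilon> (s i) = 1 \<and>
        \<epsilon> (D i) = 0 \<and>
        S (s i) = s i \<and>
        S (D i) = \<ominus>\<^bsub>H\<^esub> (s i \<otimes>\<^bsub>H\<^esub> D i))"
  unfolding Let_def
proof -
  let ?H = "hecke_hopf I m" and ?s = "gen_s I m" and ?D = "gen_D I m"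
  let ?T = "tensor_ring ?H ?H"
  interpret H: hecke_hopf_data ?H I m ?s ?D
    by (rule hecke_hopf_data_hecke_hopf)
  interpret HH: two_rings ?H ?H ..
  \<comment> \<open>Uniqueness is claimed among functions that are \<open>undefined\<close> outside
    the carrier, so the maps given by the universal property have to be cut down to it.\<close>
  have restrict: "restrict h (carrier ?H) \<in> ring_hom ?H R" if "h \<in> ring_hom ?H R" for h R
    using H.ring_hom_restrict[OF that] by simp
  from hecke_hopf_data.hecke_hopf_universal[OF H.hecke_hopf_data_tensor] obtain \<Delta>
    where \<Delta>: "\<Delta> \<in> ring_hom ?H ?T" "\<forall>i\<in>I. \<Delta> (?s i) = tens ?H ?H (?s i) (?s i) \<and>
      \<Delta> (?D i) = tens ?H ?H (?D i) \<one>\<^bsub>?H\<^esub> \<oplus>\<^bsub>?T\<^esub> tens ?H ?H (?s i) (?D i)"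
    by (rule bexE)
  from hecke_hopf_data.hecke_hopf_universal[OF hecke_hopf_data_int] obtain \<epsilon>
    where \<epsilon>: "\<epsilon> \<in> ring_hom ?H \<Z>" "\<forall>i\<in>I. \<epsilon> (?s i) = 1 \<and> \<epsilon> (?D i) = 0"
    by (rule bexE)
  from hecke_hopf_data.hecke_hopf_universal[OF H.hecke_hopf_data_opposite] obtain S
    where S: "S \<in> ring_hom ?H (opposite_ring ?H)" "\<forall>i\<in>I. S (?s i) = ?s i \<and>
      S (?D i) = \<ominus>\<^bsub>?H\<^esub> (?s i \<otimes>\<^bsub>?H\<^esub> ?D i)"
    by (rule bexE)
  interpret X: hecke_hopf_structure I m ?H ?s ?D "restrict \<Delta> (carrier ?H)" "restrict \<epsilon> (carrier ?H)" "restrict S (carrier ?H)"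
    by unfold_locales (use \<Delta> \<epsilon> S in \<open>simp_all add: restrict\<close>)
  show "\<exists>!(\<Delta>, \<epsilon>, S).
      \<Delta> \<in> extensional (carrier ?H) \<and> \<epsilon> \<in> extensional (carrier ?H) \<and> S \<in> extensional (carrier ?H) \<and>
      hopf_algebra ?H \<Delta> \<epsilon> S \<and> anti_automorphism ?H S \<and>
      (\<forall>i\<in>I.
        \<Delta> (?s i) = tens ?H ?H (?s i) (?s i) \<and>
        \<Delta> (?D i) = tens ?H ?H (?D i) \<one>\<^bsub>?H\<^esub> \<oplus>\<^bsub>?T\<^esub> tens ?H ?H (?s i) (?D i) \<and>
        \<epsilon> (?s i) = 1 \<and>
        \<epsilon> (?D i) = 0 \<and>
        S (?s i) = ?s i \<and>
        S (?D i) = \<ominus>\<^bsub>?H\<^esub> (?s i \<otimes>\<^bsub>?H\<^esub> ?D i))" (is "\<exists>!(\<Delta>, \<epsilon>, S). ?P \<Delta> \<epsilon> S")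
  proof (rule ex1I[of _ "(restrict \<Delta> (carrier ?H), restrict \<epsilon> (carrier ?H), restrict S (carrier ?H))"])
    show "case (restrict \<Delta> (carrier ?H), restrict \<epsilon> (carrier ?H), restrict S (carrier ?H)) of (\<Delta>, \<epsilon>, S) \<Rightarrow> ?P \<Delta> \<epsilon> S"
      using X.hopf_algebra X.S_anti_automorphism \<Delta> \<epsilon> S by simp
  next
    fix y assume "case y of (\<Delta>, \<epsilon>, S) \<Rightarrow> ?P \<Delta> \<epsilon> S"
    then obtain \<Delta>' \<epsilon>' S' where y: "y = (\<Delta>', \<epsilon>', S')" and P: "?P \<Delta>' \<epsilon>' S'"
      by (cases y) auto
    \<comment> \<open>\<open>hopf_algebra\<close> asks of S' additivity only; that it reverses
      products comes from \<open>anti_automorphism\<close>.\<close>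
    from P have hom: "\<Delta>' \<in> ring_hom ?H ?T" "\<epsilon>' \<in> ring_hom ?H \<Z>" "S' \<in> ring_hom ?H (opposite_ring ?H)"
      by (auto simp: hopf_algebra_def bialgebra_def bialgebra_axioms_def anti_automorphism_def ring_iso_def)
    have ext: "f = restrict g (carrier ?H)"
      if "ring R" "f \<in> extensional (carrier ?H)" "f \<in> ring_hom ?H R" "g \<in> ring_hom ?H R"
        "\<And>i. i \<in> I \<Longrightarrow> f (?s i) = g (?s i)" "\<And>i. i \<in> I \<Longrightarrow> f (?D i) = g (?D i)" for R f g
      by (rule extensionalityI[OF that(2)]) (simp_all add: hecke_hopf_hom_eqI[OF that(1,3-6)])
    have "\<Delta>' = restrict \<Delta> (carrier ?H)"
      using P \<Delta> by (intro ext[OF HH.ring_tensor_ring _ hom(1)]) simp_all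
    moreover have "\<epsilon>' = restrict \<epsilon> (carrier ?H)"
      using P \<epsilon> by (intro ext[OF int.ring_axioms _ hom(2)]) simp_all
    moreover have "S' = restrict S (carrier ?H)"
      using P S by (intro ext[OF H.ring_opposite _ hom(3)]) simp_all
    ultimately show "y = (restrict \<Delta> (carrier ?H), restrict \<epsilon> (carrier ?H), restrict S (carrier ?H))"
      using y by simp
  qed
qed

end
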